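(* Let $X$ be a topological vector space over $\mathbb K$ such that either $2<\dim_{\mathbb R}X<2^{\aleph_0}$ or $2<\dim_{\mathbb R}X'<2^{\aleph_0}$. Then there are no supercyclic strongly continuous operator semigroups $\{T_t\}_{t\in\mathbb R_+}$ on $X$.
   Context: $\mathbb K$ is either $\mathbb R$ or $\mathbb C$; all vector spaces are over $\mathbb K$ and all topological spaces are assumed Hausdorff. $\mathbb R_+=[0,\infty)$. $\dim_{\mathbb R}$ denotes algebraic dimension over $\mathbb R$. $L(X)$ is the space of continuous linear operators on $X$, and $X'$ is the space of continuous linear functionals $X\to\mathbb K$. An operator semigroup $\{T_t\}_{t\in\mathbb R_+}$ on $X$ is a family in $L(X)$ with $T_0=I$ and $T_{s+t}=T_tT_s$ for all $s,t\in\mathbb R_+$. It is strongly continuous if $t\mapsto T_tx$ is continuous from $\mathbb R_+$ to $X$ for every $x\in X$. It is supercyclic if there is $x\in X$ such that $\{zT_tx: z\in\mathbb K,\ t\in\mathbb R_+\}$ is dense in $X$. *)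

theory Defs
  imports "HOL-Analysis.Analysis" "HOL-Library.Function_Algebras"
begin

unbundle cardinal_syntax

text \<open>
  The distribution has no class of complex vector spaces, so a vector space structure is given by
  its scalar multiplication. The definitions are polymorphic in the scalar field; they are
  meant for the fields \<^typ>\<open>real\<close> and \<^typ>\<open>complex\<close>.
\<close>

locale topological_vector_space = vector_space scl
  for scl :: "'k::real_normed_field \<Rightarrow> 'a::{topological_ab_group_add,t2_space} \<Rightarrow> 'a" +
  assumes continuous_scale: "continuous_on UNIV (\<lambda>(c, x). scl c x)"

definition real_scale :: "('k::real_normed_field \<Rightarrow> 'v \<Rightarrow> 'v) \<Rightarrow> real \<Rightarrow> 'v \<Rightarrow> 'v" where
  "real_scale scl r = scl (of_real r)"

text \<open>
  Algebraic dimension of a subspace as a cardinal. (The library's \<^const>\<open>vector_space.dim\<close> is a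
  natural number and is \<open>0\<close> on infinite-dimensional spaces.) The lemma below shows that the
  choice of the basis is immaterial.
\<close>

definition alg_dim :: "('k::field \<Rightarrow> 'v::ab_group_add \<Rightarrow> 'v) \<Rightarrow> 'v set \<Rightarrow> 'v rel" where
  "alg_dim scl V =
     |SOME B. B \<subseteq> V \<and> \<not> module.dependent scl B \<and> module.span scl B = V|"

lemma alg_dim_basis:
  assumes "vector_space scl"
    and B: "B \<subseteq> V" "\<not> module.dependent scl B" "module.span scl B = V"
  shows "alg_dim scl V =o |B|"
proof -
  interpret vector_space scl by fact
  define C where "C = (SOME B. B \<subseteq> V \<and> independent B \<and> span B = V)"
  have "C \<subseteq> V \<and> independent C \<and> span C = V"
    unfolding C_def by (rule someI[of _ B]) (use B in auto)
  then obtain f where "bij_betw f C B"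
    using bij_if_span_eq_span_bases[of C B] B by auto
  then show ?thesis
    unfolding alg_dim_def C_def[symmetric] by (rule card_of_ordIsoI)
qed

definition continuous_operators ::
    "('k::real_normed_field \<Rightarrow> 'a::{ab_group_add,topological_space} \<Rightarrow> 'a) \<Rightarrow> ('a \<Rightarrow> 'a) set" where
  "continuous_operators scl = {T. Vector_Spaces.linear scl scl T \<and> continuous_on UNIV T}"

definition continuous_dual ::
    "('k::real_normed_field \<Rightarrow> 'a::{ab_group_add,topological_space} \<Rightarrow> 'a) \<Rightarrow> ('a \<Rightarrow> 'k) set" where
  "continuous_dual scl = {f. Vector_Spaces.linear scl (*) f \<and> continuous_on UNIV f}"

definition dual_scale :: "'k::field \<Rightarrow> ('a \<Rightarrow> 'k) \<Rightarrow> 'a \<Rightarrow> 'k" where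
  "dual_scale c f = (\<lambda>x. c * f x)"

text \<open>
  \<^term>\<open>alg_dim (real_scale scl) UNIV\<close> is the real dimension of the whole space and
  \<^term>\<open>alg_dim (real_scale dual_scale) (continuous_dual scl)\<close> that of its dual, with the pointwise
  operations.
\<close>

definition real_dim :: "('k::real_normed_field \<Rightarrow> 'a::ab_group_add \<Rightarrow> 'a) \<Rightarrow> 'a rel" where
  "real_dim scl = alg_dim (real_scale scl) UNIV"

definition real_dim_dual ::
    "('k::real_normed_field \<Rightarrow> 'a::{ab_group_add,topological_space} \<Rightarrow> 'a) \<Rightarrow> ('a \<Rightarrow> 'k) rel" where
  "real_dim_dual scl = alg_dim (real_scale dual_scale) (continuous_dual scl)"

text \<open>A semigroup is a function on all of \<^typ>\<open>real\<close> of which only the values on \<open>[0, \<infinity>)\<close> matter.\<close>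

definition operator_semigroup ::
    "('k::real_normed_field \<Rightarrow> 'a::{ab_group_add,topological_space} \<Rightarrow> 'a) \<Rightarrow> (real \<Rightarrow> 'a \<Rightarrow> 'a) \<Rightarrow> bool" where
  "operator_semigroup scl T \<longleftrightarrow>
     (\<forall>t\<ge>0. T t \<in> continuous_operators scl) \<and>
     T 0 = id \<and>
     (\<forall>s\<ge>0. \<forall>t\<ge>0. T (s + t) = T t \<circ> T s)"

definition strongly_continuous :: "(real \<Rightarrow> 'a::topological_space \<Rightarrow> 'a) \<Rightarrow> bool" where
  "strongly_continuous T \<longleftrightarrow> (\<forall>x. continuous_on {0..} (\<lambda>t. T t x))"

definition supercyclic ::
    "('k::real_normed_field \<Rightarrow> 'a::topological_space \<Rightarrow> 'a) \<Rightarrow> (real \<Rightarrow> 'a \<Rightarrow> 'a) \<Rightarrow> bool" where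
  "supercyclic scl T \<longleftrightarrow> (\<exists>x. closure {scl z (T t x) | z t. 0 \<le> t} = UNIV)"

end

theory Submission
  imports Defs "HOL-Computational_Algebra.Fundamental_Theorem_Algebra"
begin

text \<open>
  Every \<open>T t\<close> of a supercyclic strongly continuous semigroup has dense range. If the space or its
  dual has real dimension below the continuum, then the orbit of a vector, or that of a functional
  under the adjoint semigroup, is a curve some arc of which lies in a finite-dimensional subspace:
  otherwise a Cantor scheme produces continuum many independent points of the curve. By the
  semigroup law such a curve ends up in a finite-dimensional invariant subspace. Together with the
  density of the ranges this yields a finite-dimensional invariant space of continuous functionals
  containing three independent ones over the reals, or two over the complex numbers.

  On that space (complexified in the real case) the commuting adjoint operators can be
  triangularised, which gives functionals \<open>f\<close> and \<open>g\<close> on whose ratio the semigroup acts by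
  multiplication with a character or by translation. So either \<open>\<bar>g / f\<bar>\<close> is monotone along the
  orbit or \<open>g / f\<close> stays on a half-line, and neither is compatible with a dense projective orbit.
\<close>

section \<open>Topological vector spaces\<close>

text \<open>The space need not be locally convex and may have no nonzero continuous functional, so
  duality cannot show that the ranges are dense. That step works in the space itself, through the
  time at which the orbit enters a closed invariant subspace. Both dimension hypotheses are steered
  to one statement on the dual: a small space is finite-dimensional by the density of the ranges. A
  functional enters an invariant space only after composition with some \<open>T a\<close>, but this
  composition is injective on continuous functionals, so independence survives. The counts two and
  three are sharp: a complex line and a real plane with rotations carry supercyclic semigroups. Over
  the reals the kernel of a complex-valued functional can have codimension two, so \<open>f\<close>
  and its conjugate are treated together and a third functional is needed.\<close>

lemma closed_add_compact:
  fixes L C :: "'a::{topological_ab_group_add,t2_space} set"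
  assumes "closed L" "compact C"
  shows "closed {l + c | l c. l \<in> L \<and> c \<in> C}"
proof -
  \<comment> \<open>Compactness of \<open>C\<close> makes the projection closed;
    \<open>L + C\<close> is the image of the closed set of pairs \<open>(c, v)\<close> with
    \<open>v - c\<close> in \<open>L\<close>.\<close>
  have "closed_map (prod_topology (top_of_set C) euclidean) (euclidean :: 'a topology) snd"
    using assms(2) by (intro closed_map_snd) (simp add: compact_space_subtopology)
  then have proj: "closed_map (top_of_set (C \<times> UNIV)) (euclidean :: 'a topology) snd"
    using subtopology_Times[of euclidean euclidean C "UNIV::'a set"] by simp
  have "closed ((\<lambda>p::'a\<times>'a. snd p - fst p) -` L)"
    using assms(1) by (intro closed_vimage continuous_intros) 
  then have "closedin (top_of_set (C \<times> UNIV)) ((C \<times> UNIV) \<inter> ((\<lambda>p::'a\<times>'a. snd p - fst p) -` L))"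
    by (simp add: closedin_closed_Int)
  then have "closed (snd ` ((C \<times> UNIV) \<inter> ((\<lambda>p::'a\<times>'a. snd p - fst p) -` L)))"
    using proj unfolding closed_map_def by (metis closed_closedin)
  also have "snd ` ((C \<times> UNIV) \<inter> ((\<lambda>p::'a\<times>'a. snd p - fst p) -` L))
      = {l + c | l c. l \<in> L \<and> c \<in> C}"
    by (force simp: image_iff)
  finally show ?thesis .
qed

context topological_vector_space
begin

lemma continuous_on_scl:
  assumes "continuous_on S g" "continuous_on S h"
  shows "continuous_on S (\<lambda>u. scl (g u) (h u))"
  using continuous_on_compose2[OF continuous_scale continuous_on_Pair[OF assms]] by simp

lemma tendsto_scl:
  assumes "(g \<longlongrightarrow> c) F" "(h \<longlongrightarrow> x) F"
  shows "((\<lambda>u. scl (g u) (h u)) \<longlongrightarrow> scl c x) F"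
proof -
  have "isCont (\<lambda>(c, x). scl c x) (c, x)"
    using continuous_scale by (auto simp: continuous_on_eq_continuous_at)
  from isCont_tendsto_compose[OF this tendsto_Pair[OF assms]] show ?thesis by simp
qed

lemma zero_nhd_scl:
  assumes "open N" "0 \<in> N"
  obtains d V where "d > 0" "open V" "0 \<in> V" "\<And>c v. norm c < d \<Longrightarrow> v \<in> V \<Longrightarrow> scl c v \<in> N"
proof -
  have "open ((\<lambda>p. scl (fst p) (snd p)) -` N)"
    using assms(1) by (intro open_vimage continuous_on_scl continuous_intros)
  moreover have "(0, 0) \<in> ((\<lambda>p. scl (fst p) (snd p)) -` N)"
    using assms(2) by simp
  ultimately obtain A V where *: "open A" "open V" "0 \<in> A" "0 \<in> V"
    "A \<times> V \<subseteq> ((\<lambda>p. scl (fst p) (snd p)) -` N)"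
    by (rule open_prod_elim) auto
  then obtain d where "d > 0" "ball 0 d \<subseteq> A"
    using openE by blast
  with * show ?thesis
    by (intro that[of d V]) (auto simp: subset_iff)
qed

lemma absorbing:
  assumes "open V" "0 \<in> V"
  obtains R :: real where "R > 0" "scl (of_real (inverse R)) y \<in> V"
proof -
  have "((\<lambda>R. scl (of_real (inverse R)) y) \<longlongrightarrow> scl (of_real 0) y) at_top"
    by (intro tendsto_scl tendsto_of_real tendsto_inverse_0_at_top filterlim_ident tendsto_const)
  then have "\<forall>\<^sub>F R in at_top. scl (of_real (inverse R)) y \<in> V"
    using assms by (auto simp: tendsto_def)
  then obtain R where "\<And>r. r \<ge> R \<Longrightarrow> scl (of_real (inverse r)) y \<in> V"
    by (auto simp: eventually_at_top_linorder)
  then show ?thesis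
    by (intro that[of "max R 1"]) auto
qed

text \<open>Near a given point the scalar factor of \<open>l + scl z c\<close> is bounded, so the sum is locally that
  of a closed and a compact set.\<close>

lemma closed_add_scl_compact:
  assumes loc: "\<And>r. compact (cball (0::'k) r)"
    and L: "closed L" and scL: "\<And>z l. l \<in> L \<Longrightarrow> scl z l \<in> L"
    and C: "compact C" and disj: "\<And>l c. l \<in> L \<Longrightarrow> c \<in> C \<Longrightarrow> l + c \<noteq> 0"
  shows "closed {l + scl z c | l z c. l \<in> L \<and> c \<in> C}" (is "closed ?S")
proof -
  define N where "N = - {l + c | l c. l \<in> L \<and> c \<in> C}"
  have "open N" "0 \<in> N"
    unfolding N_def using closed_add_compact[OF L C] disj by force+
  then obtain d V where d: "d > 0" and V: "open V" "0 \<in> V"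
    and dV: "\<And>c v. norm c < d \<Longrightarrow> v \<in> V \<Longrightarrow> scl c v \<in> N"
    using zero_nhd_scl by metis
  have "y \<in> ?S" if y: "y \<in> closure ?S" for y
  proof -
    obtain R where R: "R > 0" "scl (of_real (inverse R)) y \<in> V"
      using absorbing[OF V] by metis
    define U where "U = (\<lambda>v. scl (of_real (inverse R)) v) -` V"
    have U: "open U" "y \<in> U"
      unfolding U_def using R by (auto intro!: open_vimage V continuous_on_scl continuous_intros)
    define D where "D = (\<lambda>p. scl (fst p) (snd p)) ` (cball 0 (R / d) \<times> C)"
    have D: "compact D"
      unfolding D_def using loc C
      by (intro compact_continuous_image continuous_on_scl continuous_intros compact_Times)
    define S' where "S' = {l + c | l c. l \<in> L \<and> c \<in> D}"
    have "closed S'"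
      unfolding S'_def by (intro closed_add_compact L D)
    \<comment> \<open>For larger \<open>z\<close>, scaling a point of \<open>U\<close> by
      \<open>inverse z\<close> lands in \<open>N\<close>, yet the result
      \<open>scl (inverse z) l + c\<close> lies in \<open>L + C\<close>, which \<open>N\<close>
      avoids.\<close>
    have bound: "norm z \<le> R / d" if "l \<in> L" "c \<in> C" "l + scl z c \<in> U" for l z c
    proof (rule ccontr)
      assume "\<not> ?thesis"
      then have z: "norm z > R / d" by simp
      then have "z \<noteq> 0" using R d by (auto simp: divide_less_0_iff)
      have "norm (of_real R / z) < d"
        using z R d \<open>z \<noteq> 0\<close> by (simp add: norm_divide field_simps)
      then have "scl (of_real R / z) (scl (of_real (inverse R)) (l + scl z c)) \<in> N"
        using that by (intro dV) (auto simp: U_def)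
      also have "scl (of_real R / z) (scl (of_real (inverse R)) (l + scl z c)) = scl (inverse z) l + c"
        using R \<open>z \<noteq> 0\<close> by (simp add: scale_right_distrib field_simps)
      finally show False
        using that scL unfolding N_def by blast
    qed
    have sub: "?S \<inter> U \<subseteq> S'"
    proof
      fix u assume "u \<in> ?S \<inter> U"
      then obtain l z c where u: "u = l + scl z c" "l \<in> L" "c \<in> C" "u \<in> U" by blast
      with bound have "(z, c) \<in> cball 0 (R / d) \<times> C" by simp
      then have "scl z c \<in> D" unfolding D_def by force
      with u show "u \<in> S'" unfolding S'_def by blast
    qed
    have "y \<in> closure (?S \<inter> U)"
      using U y open_Int_closure_subset[OF U(1), of ?S] by (auto simp: Int_commute)
    then have "y \<in> S'"
      using closure_minimal[OF sub \<open>closed S'\<close>] by auto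
    then obtain l z c where "y = l + scl z c" "l \<in> L" "c \<in> C"
      unfolding S'_def D_def by auto
    then show ?thesis by blast
  qed
  then have "closure ?S \<subseteq> ?S" ..
  then show ?thesis
    using closure_subset_eq by blast
qed

text \<open>Adding one vector is \<open>closed_add_scl_compact\<close> for the closed subspace
  \<open>span F\<close> and the compact set \<open>{e}\<close>; the sums avoid 0 because
  \<open>e\<close> is not in \<open>span F\<close>.\<close>

lemma closed_span_finite:
  assumes loc: "\<And>r. compact (cball (0::'k) r)" and "finite F"
  shows "closed (span F)"
  using assms(2)
proof (induction F)
  case empty
  then show ?case by (simp add: span_empty)
next
  case (insert e F)
  show ?case
  proof (cases "e \<in> span F")
    case True
    then show ?thesis using insert by (simp add: span_redundant)
  next
    case False
    have "closed {l + scl z c | l z c. l \<in> span F \<and> c \<in> {e}}"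
    proof (rule closed_add_scl_compact[OF loc insert.IH])
      show "l + c \<noteq> 0" if "l \<in> span F" "c \<in> {e}" for l c
        using that False by (metis add_eq_0_iff2 singletonD span_neg add.commute minus_minus)
    qed (auto intro: span_scale)
    also have "{l + scl z c | l z c. l \<in> span F \<and> c \<in> {e}} = span (insert e F)"
    proof (intro set_eqI iffI)
      fix y assume "y \<in> span (insert e F)"
      then obtain k where "y - scl k e \<in> span F"
        by (auto simp: span_insert)
      then show "y \<in> {l + scl z c | l z c. l \<in> span F \<and> c \<in> {e}}"
        by (auto intro!: exI[of _ "y - scl k e"] exI[of _ k])
    next
      fix y assume "y \<in> {l + scl z c | l z c. l \<in> span F \<and> c \<in> {e}}"
      then obtain l z where "y = l + scl z e" "l \<in> span F" by blast
      then show "y \<in> span (insert e F)"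
        using span_mono[of F "insert e F"] by (auto intro!: span_add span_scale intro: span_base)
    qed
    finally show ?thesis .
  qed
qed

text \<open>The hyperplane \<open>f = 1\<close> is a translate of the kernel, hence closed, and
  misses 0. On a neighbourhood \<open>V\<close> whose small multiples avoid it, \<open>f\<close> is
  bounded by \<open>1 / d\<close>, for otherwise scaling \<open>v\<close> by
  \<open>inverse (f v)\<close> would reach the hyperplane. Boundedness near 0 gives
  continuity.\<close>

lemma continuous_functional:
  fixes f :: "'a \<Rightarrow> 'k"
  assumes lin: "Vector_Spaces.linear scl (*) f" and ker: "closed {v. f v = 0}"
  shows "continuous_on UNIV f"
proof (cases "\<forall>v. f v = 0")
  case True
  then have "f = (\<lambda>_. 0)" by auto
  then show ?thesis by simp
next
  case False
  interpret f: Vector_Spaces.linear scl "(*)" f by fact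
  obtain e' where "f e' \<noteq> 0" using False by auto
  define e where "e = scl (inverse (f e')) e'"
  have e: "f e = 1" using \<open>f e' \<noteq> 0\<close> by (simp add: e_def f.scale)
  have "f -` {1} = (\<lambda>v. v - e) -` {v. f v = 0}"
    using e by (auto simp: f.diff)
  then have "closed (f -` {1})"
    using closed_vimage[OF ker, of "\<lambda>v. v - e"] by (simp add: continuous_intros)
  then have "open (- (f -` {1}))" "0 \<in> - (f -` {1})"
    by (auto simp: f.zero)
  then obtain d V where d: "d > 0" and V: "open V" "0 \<in> V"
    and dV: "\<And>c v. norm c < d \<Longrightarrow> v \<in> V \<Longrightarrow> scl c v \<in> - (f -` {1})"
    using zero_nhd_scl by metis
  have bd: "norm (f v) \<le> 1 / d" if "v \<in> V" for v
  proof (rule ccontr)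
    assume "\<not> ?thesis"
    then have "norm (f v) > 1 / d" by simp
    moreover from this have "f v \<noteq> 0" using d by (auto simp: divide_less_0_iff)
    ultimately have "norm (inverse (f v)) < d"
      using d by (simp add: norm_inverse norm_divide field_simps)
    from dV[OF this that] show False
      using \<open>f v \<noteq> 0\<close> by (simp add: f.scale)
  qed
  have "\<exists>U. open U \<and> v \<in> U \<and> (\<forall>u\<in>U. dist (f u) (f v) < e)" if "e > 0" for v e
  proof -
    define c where "c = (of_real (e * d / 2) :: 'k)"
    have c: "norm c = e * d / 2" "c \<noteq> 0" using d that by (auto simp: c_def norm_mult)
    define U where "U = (\<lambda>u. scl (inverse c) (u - v)) -` V"
    have "open U" "v \<in> U"
      unfolding U_def using V by (auto intro!: open_vimage continuous_on_scl continuous_intros)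
    moreover have "dist (f u) (f v) < e" if "u \<in> U" for u
    proof -
      have "norm (inverse c * (f u - f v)) \<le> 1 / d"
        using bd[of "scl (inverse c) (u - v)"] that by (simp add: U_def f.scale f.diff)
      then have "norm (f u - f v) \<le> e / 2"
        using c d \<open>e > 0\<close> by (simp add: norm_divide norm_mult divide_simps split: if_splits)
      also have "\<dots> < e" using \<open>e > 0\<close> by simp
      finally show ?thesis by (simp add: dist_norm)
    qed
    ultimately show ?thesis by blast
  qed
  then have "(f \<longlongrightarrow> f v) (at v)" for v
    by (intro tendstoI) (fastforce simp: eventually_at_topological)
  then show ?thesis
    by (auto simp: continuous_on_eq_continuous_at isCont_def)
qed

lemma real_scale: "topological_vector_space (real_scale scl)"
proof
  show "continuous_on UNIV (\<lambda>(c, x). real_scale scl c x)"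
    unfolding real_scale_def split_beta by (intro continuous_on_scl continuous_intros)
qed (simp_all add: real_scale_def scale_right_distrib scale_left_distrib)

end


section \<open>Supercyclic semigroups\<close>

lemma (in topological_vector_space) subspace_closure:
  assumes "subspace M"
  shows "subspace (closure M)"
proof (rule subspaceI)
  show "0 \<in> closure M"
    using subspace_0[OF assms] closure_subset by auto
next
  fix u v assume "u \<in> closure M" "v \<in> closure M"
  then have "(u, v) \<in> closure (M \<times> M)" by (simp add: closure_Times)
  moreover have "(\<lambda>p. fst p + snd p) ` closure (M \<times> M) \<subseteq> closure M"
    using subspace_add[OF assms]
    by (intro image_closure_subset continuous_intros)
      (auto intro!: subsetD[OF closure_subset])
  ultimately show "u + v \<in> closure M" by force
next
  fix c v assume "v \<in> closure M"
  moreover have "scl c ` closure M \<subseteq> closure M"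
    using subspace_scale[OF assms]
    by (intro image_closure_subset continuous_on_scl continuous_intros)
      (auto intro!: subsetD[OF closure_subset])
  ultimately show "scl c v \<in> closure M" by blast
qed

locale supercyclic_semigroup = topological_vector_space scl
  for scl :: "'k::{real_normed_field,heine_borel} \<Rightarrow> 'a::{topological_ab_group_add,t2_space} \<Rightarrow> 'a" +
  fixes T :: "real \<Rightarrow> 'a \<Rightarrow> 'a" and x :: 'a
  assumes semigroup: "operator_semigroup scl T"
    and strongly_cont: "strongly_continuous T"
    and dense_orbit: "closure {scl z (T t x) | z t. 0 \<le> t} = UNIV"
begin

lemma linear_T: "t \<ge> 0 \<Longrightarrow> Vector_Spaces.linear scl scl (T t)"
  and continuous_T: "t \<ge> 0 \<Longrightarrow> continuous_on UNIV (T t)"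
  and T_0: "T 0 v = v"
  and T_T: "s \<ge> 0 \<Longrightarrow> t \<ge> 0 \<Longrightarrow> T t (T s v) = T (s + t) v"
  using semigroup by (auto simp: operator_semigroup_def continuous_operators_def)

lemma T_add: "t \<ge> 0 \<Longrightarrow> T t (u + v) = T t u + T t v"
  and T_scl: "t \<ge> 0 \<Longrightarrow> T t (scl c v) = scl c (T t v)"
  using linear_T[of t]
  by (auto simp: Vector_Spaces.linear_def module_hom_def module_hom_axioms_def)

lemma T_zero: "t \<ge> 0 \<Longrightarrow> T t 0 = 0"
  using T_scl[of t 0 0] by simp

lemma continuous_orbit: "continuous_on {0..} (\<lambda>t. T t v)"
  using strongly_cont by (auto simp: strongly_continuous_def)

lemma orbit_closed_induct:
  assumes "closed {v. P v}" "\<And>z t. t \<ge> 0 \<Longrightarrow> P (scl z (T t x))"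
  shows "P v"
proof -
  have "closure {scl z (T t x) | z t. 0 \<le> t} \<subseteq> {v. P v}"
    using assms by (intro closure_minimal) auto
  then show ?thesis using dense_orbit by auto
qed

text \<open>The closure \<open>M\<close> of the range is invariant. If it is proper,
  \<open>x\<close> lies outside, and the orbit enters \<open>M\<close> at a first time
  \<open>t0 \<le> s\<close> and stays there. So the projective orbit lies in \<open>M\<close>
  together with the scalar multiples of the arc over \<open>[0, s]\<close>. Both sets are closed,
  the second because the arc avoids 0, so they cover the space. A sum of two orbit vectors escapes
  both.\<close>

lemma dense_range_small:
  assumes s: "s > 0" and nz: "\<And>t. 0 \<le> t \<Longrightarrow> t \<le> s \<Longrightarrow> T t x \<noteq> 0"
  shows "closure (range (T s)) = UNIV"
proof (rule ccontr)
  assume neq: "closure (range (T s)) \<noteq> UNIV"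
  define M where "M = closure (range (T s))"
  interpret Ts: Vector_Spaces.linear scl scl "T s" using linear_T s by simp
  have "subspace M"
    unfolding M_def by (intro subspace_closure Ts.subspace_image subspace_UNIV)
  note M = subspace_add[OF this] subspace_scale[OF this] subspace_diff[OF this] subspace_0[OF this]
  have "closed M" by (simp add: M_def)
  have TM: "T t v \<in> M" if "v \<in> M" "t \<ge> 0" for v t
  proof -
    have "T t (T s w) = T s (T t w)" for w
      using s that(2) by (simp add: T_T add.commute)
    then have "T t ` range (T s) \<subseteq> range (T s)" by auto
    then have "T t ` range (T s) \<subseteq> M"
      unfolding M_def using closure_subset by (rule subset_trans)
    then have "T t ` M \<subseteq> M"
      unfolding M_def
      by (intro image_closure_subset continuous_on_subset[OF continuous_T[OF that(2)]]) auto
    with that show ?thesis by blast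
  qed
  have xM: "x \<notin> M"
  proof
    assume "x \<in> M"
    have "v \<in> M" for v
    proof (rule orbit_closed_induct[of "\<lambda>v. v \<in> M"])
      show "scl z (T t x) \<in> M" if "t \<ge> 0" for z t
        using TM[OF \<open>x \<in> M\<close> that] M(2) by blast
    qed (use \<open>closed M\<close> in simp)
    then show False using neq by (auto simp: M_def)
  qed
  define Z where "Z = {0..s} \<inter> (\<lambda>t. T t x) -` M"
  have cZ: "compact Z"
  proof -
    have "closed Z" unfolding Z_def
      by (intro continuous_closed_preimage \<open>closed M\<close> continuous_on_subset[OF continuous_orbit]) auto
    moreover have "bounded Z" unfolding Z_def by (rule bounded_subset[of "{0..s}"]) auto
    ultimately show ?thesis by (simp add: compact_eq_bounded_closed)
  qed
  have "T s x \<in> M"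
    unfolding M_def using closure_subset[of "range (T s)"] by auto
  then have "s \<in> Z"
    using s by (simp add: Z_def)
  then have "\<exists>t0\<in>Z. \<forall>t\<in>Z. t0 \<le> t"
    by (intro compact_attains_inf[OF cZ]) auto
  then obtain t0 where t0: "t0 \<in> Z" "\<And>t. t \<in> Z \<Longrightarrow> t0 \<le> t" by blast
  \<comment> \<open>Half the entry time: for \<open>t \<le> r < 2 * t\<close> the vector
    \<open>T r x\<close> is outside \<open>M\<close> while \<open>T (t + r) x\<close> is inside, so
    \<open>T r (x + T t x)\<close> is outside.\<close>
  define t where "t = t0 / 2"
  have "t0 \<noteq> 0" using t0(1) xM by (auto simp: Z_def T_0)
  then have t: "t > 0" "t0 = 2 * t" "2 * t \<le> s" using t0(1) by (auto simp: Z_def t_def)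
  have out: "T r x \<notin> M" if "0 \<le> r" "r < 2 * t" for r
    using t0(2)[of r] that t by (auto simp: Z_def)
  have ins: "T r x \<in> M" if "r \<ge> 2 * t" for r
    using TM[of "T t0 x" "r - t0"] t0(1) that t T_T[of t0 "r - t0"] by (simp add: Z_def)
  define u where "u = x + T t x"
  have Tu: "T r u \<notin> M" if "t \<le> r" "r < 2 * t" for r
  proof
    assume "T r u \<in> M"
    moreover have "T r u = T r x + T (t + r) x"
      using that t by (simp add: u_def T_add T_T)
    moreover have "T (t + r) x \<in> M" using ins that by simp
    ultimately have "T r x \<in> M" using M(3) by (metis add_diff_cancel_right')
    then show False using out that t by simp
  qed
  have "u \<notin> M" using Tu[of t] TM[of u t] t by auto
  define S where "S = {l + scl z c | l z c. l \<in> {0} \<and> c \<in> (\<lambda>t. T t x) ` {0..s}}"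
  have "closed S"
    unfolding S_def
  proof (rule closed_add_scl_compact)
    show "compact ((\<lambda>t. T t x) ` {0..s})"
      by (intro compact_continuous_image continuous_on_subset[OF continuous_orbit]) auto
  qed (use nz in auto)
  have "u \<in> M \<union> S"
  proof (rule orbit_closed_induct)
    show "closed {v. v \<in> M \<union> S}" using closed_Un[OF \<open>closed M\<close> \<open>closed S\<close>] by (simp only: Collect_mem_eq)
    show "scl z (T r x) \<in> M \<union> S" if "r \<ge> 0" for z r
    proof (cases "r \<le> s")
      case True
      then have "T r x \<in> (\<lambda>t. T t x) ` {0..s}" using that by auto
      then show ?thesis unfolding S_def
        by (intro UnI2 CollectI exI[of _ 0] exI[of _ z] exI[of _ "T r x"]) simp
    next
      case False
      then show ?thesis using ins[of r] t M(2) by auto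
    qed
  qed
  then obtain z r where zr: "u = scl z (T r x)" "0 \<le> r" "r \<le> s"
    using \<open>u \<notin> M\<close> by (auto simp: S_def)
  then have "r < 2 * t" using ins[of r] M(2) \<open>u \<notin> M\<close> by force
  show False
  proof (cases "r = 0")
    case False
    \<comment> \<open>A delay in \<open>[t, 2 * t)\<close> that carries \<open>T r x\<close> past
      the entry time \<open>2 * t\<close>; there is one because \<open>r > 0\<close>.\<close>
    define r' where "r' = max (2 * t - r) t"
    have r': "t \<le> r'" "r' < 2 * t" "r + r' \<ge> 2 * t"
      using zr \<open>r < 2 * t\<close> False t by (auto simp: r'_def)
    have "T r' u = scl z (T (r + r') x)"
      using zr r' t by (simp add: T_scl T_T)
    then have "T r' u \<in> M" using ins r' M by simp
    with Tu r' show False by simp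
  next
    \<comment> \<open>Now \<open>T t x\<close> is a multiple of \<open>x\<close> by
      \<open>z - 1 \<noteq> 0\<close>, so \<open>T (2 * t) x\<close> is a nonzero multiple of
      \<open>x\<close> and would drag \<open>x\<close> into \<open>M\<close>.\<close>
    case True
    then have Tt: "T t x = scl (z - 1) x"
      using zr by (simp add: u_def T_0 scale_left_diff_distrib algebra_simps)
    have "T (2 * t) x = scl (z - 1) (scl (z - 1) x)"
      using T_T[of t t x] t by (simp add: Tt T_scl del: scale_scale)
    then have e: "scl (z - 1) (scl (z - 1) x) \<in> M" using ins[of "2 * t"] by simp
    have "z \<noteq> 1" using Tt out[of t] t M(4) by auto
    then have "scl (inverse (z - 1)) (scl (z - 1) y) = y" for y by simp
    then have "x \<in> M"
      using M(2)[OF M(2)[OF e, of "inverse (z - 1)"], of "inverse (z - 1)"] by (simp only:)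
    then show False using xM by simp
  qed
qed

text \<open>For small \<open>s\<close> the orbit avoids 0 on \<open>[0, s]\<close> by continuity, so
  \<open>dense_range_small\<close> applies. Powers of \<open>T s\<close> keep a dense range, and the
  range of \<open>T t\<close> contains that of \<open>T (real n * s)\<close> once
  \<open>real n * s \<ge> t\<close>.\<close>

lemma dense_range:
  assumes nontriv: "\<exists>v::'a. v \<noteq> 0" and "t \<ge> 0"
  shows "closure (range (T t)) = UNIV"
proof -
  have "x \<noteq> 0"
  proof
    assume "x = 0"
    have "v = 0" for v :: 'a
      by (rule orbit_closed_induct[of "\<lambda>v. v = 0"]) (use \<open>x = 0\<close> T_zero in auto)
    with nontriv show False by auto
  qed
  have "((\<lambda>t. T t x) \<longlongrightarrow> T 0 x) (at 0 within {0..})"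
    using continuous_orbit by (auto simp: continuous_on_def)
  then have "\<forall>\<^sub>F t in at 0 within {0..}. T t x \<in> - {0}"
    using \<open>x \<noteq> 0\<close> by (intro topological_tendstoD) (auto simp: T_0)
  then obtain d where d: "d > 0" "\<And>t. t \<ge> 0 \<Longrightarrow> t < d \<Longrightarrow> t \<noteq> 0 \<Longrightarrow> T t x \<noteq> 0"
    by (auto simp: eventually_at dist_real_def)
  define s where "s = d / 2"
  have s: "s > 0" using d by (simp add: s_def)
  have ds: "closure (range (T s)) = UNIV"
  proof (rule dense_range_small[OF s])
    show "T r x \<noteq> 0" if "0 \<le> r" "r \<le> s" for r
      using d(2)[of r] that d(1) \<open>x \<noteq> 0\<close> by (cases "r = 0") (auto simp: s_def T_0)
  qed
  have *: "closure (range (T (real n * s))) = UNIV" for n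
  proof (induction n)
    case (Suc n)
    have "T s (T (real n * s) w) = T (real (Suc n) * s) w" for w
      using T_T[of "real n * s" s w] s by (simp add: algebra_simps)
    then have "T s ` range (T (real n * s)) \<subseteq> closure (range (T (real (Suc n) * s)))"
      using closure_subset[of "range (T (real (Suc n) * s))"] by auto
    then have "T s ` closure (range (T (real n * s))) \<subseteq> closure (range (T (real (Suc n) * s)))"
      using s by (intro image_closure_subset continuous_on_subset[OF continuous_T]) auto
    then have "range (T s) \<subseteq> closure (range (T (real (Suc n) * s)))"
      by (simp add: Suc.IH)
    then have "closure (range (T s)) \<subseteq> closure (range (T (real (Suc n) * s)))"
      by (metis closure_mono closure_closure)
    then show ?case using ds by auto
  qed (auto simp: T_0)
  obtain n where n: "t \<le> real n * s"
    using s by (metis ex_less_of_nat_mult less_imp_le)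
  have "range (T (real n * s)) \<subseteq> range (T t)"
  proof clarify
    fix v
    have "T (real n * s) v = T t (T (real n * s - t) v)"
      using T_T[of "real n * s - t" t v] n \<open>t \<ge> 0\<close> by simp
    then show "T (real n * s) v \<in> range (T t)" by simp
  qed
  then show ?thesis
    using closure_mono[of "range (T (real n * s))" "range (T t)"] *[of n] by auto
qed

text \<open>For linear \<open>f\<close> this is the injectivity of composition with
  \<open>T t\<close> on continuous functionals. The condition \<open>f 0 = 0\<close> covers the zero
  space, which \<open>dense_range\<close> excludes.\<close>

lemma comp_T_eq_0:
  fixes f :: "'a \<Rightarrow> 'b::{t2_space,zero}"
  assumes "continuous_on UNIV f" "t \<ge> 0" "\<And>v. f (T t v) = 0" and 0: "f 0 = 0"
  shows "f v = 0"
proof (cases "\<exists>v::'a. v \<noteq> 0")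
  case True
  have "closed {v. f v = 0}"
    using assms(1) closed_Collect_eq[of f "\<lambda>_. 0"] by simp
  then have "closure (range (T t)) \<subseteq> {v. f v = 0}"
    using assms by (intro closure_minimal) auto
  then show ?thesis using dense_range[OF True assms(2)] by auto
qed (use 0 in metis)

end

section \<open>Ratios of functionals along the orbit\<close>

lemma additive_continuous_linear:
  fixes d :: "real \<Rightarrow> 'a::real_normed_vector"
  assumes add: "\<And>s t. s \<ge> 0 \<Longrightarrow> t \<ge> 0 \<Longrightarrow> d (s + t) = d s + d t"
    and cont: "continuous_on {0..} d" and "t \<ge> 0"
  shows "d t = t *\<^sub>R d 1"
proof -
  have mult: "d (real n * s) = real n *\<^sub>R d s" if "s \<ge> 0" for n s
  proof (induction n)
    case 0
    show ?case using add[of 0 0] by simp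
  next
    case (Suc n)
    then show ?case using add[of "real n * s" s] that by (simp add: algebra_simps)
  qed
  have rat: "d q = q *\<^sub>R d 1" if q0: "q \<in> \<rat>" "q \<ge> 0" for q
  proof -
    obtain m n where mn: "n \<noteq> 0" "\<bar>q\<bar> = real m / real n"
      by (rule Rats_abs_nat_div_natE[OF q0(1)])
    then have q: "q = real m / real n" using q0 by simp
    then have "real n * q = real m" using mn by simp
    then have "real n *\<^sub>R d q = real m *\<^sub>R d 1"
      using mult[OF q0(2), of n] mult[of 1 m] by simp
    then have "(1 / real n) *\<^sub>R (real n *\<^sub>R d q) = (1 / real n) *\<^sub>R (real m *\<^sub>R d 1)" by simp
    then have "d q = (real m / real n) *\<^sub>R d 1" using mn(1) by simp
    then show ?thesis by (simp only: q[symmetric])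
  qed
  \<comment> \<open>Dyadic approximations from above, which stay in the half-line where
    \<open>d\<close> is additive and continuous.\<close>
  define q where "q n = real_of_int \<lceil>t * 2 ^ n\<rceil> / 2 ^ n" for n
  have q: "q n \<in> \<rat>" "q n \<ge> t" "q n - t \<le> (1 / 2) ^ n" for n
  proof -
    show "q n \<in> \<rat>" unfolding q_def by simp
    show "q n \<ge> t" unfolding q_def by (simp add: pos_le_divide_eq)
    have "real_of_int \<lceil>t * 2 ^ n\<rceil> \<le> t * 2 ^ n + 1" by linarith
    then have "q n \<le> (t * 2 ^ n + 1) / 2 ^ n"
      unfolding q_def by (intro divide_right_mono) auto
    then show "q n - t \<le> (1 / 2) ^ n"
      by (simp add: add_divide_distrib power_divide)
  qed
  have q_nonneg: "q n \<ge> 0" for n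
    using q(2)[of n] \<open>t \<ge> 0\<close> by linarith
  have "(\<lambda>n. q n - t) \<longlonglongrightarrow> 0"
    by (rule tendsto_sandwich[of "\<lambda>_. 0" _ _ "\<lambda>n. (1 / 2) ^ n"])
      (use q(2,3) in \<open>simp_all add: LIMSEQ_realpow_zero\<close>)
  then have lim: "q \<longlonglongrightarrow> t" by (simp add: LIM_zero_iff)
  have "(\<lambda>n. d (q n)) \<longlonglongrightarrow> d t"
    by (rule continuous_on_tendsto_compose[OF cont lim])
      (use q_nonneg \<open>t \<ge> 0\<close> in simp_all)
  moreover have "(\<lambda>n. d (q n)) \<longlonglongrightarrow> t *\<^sub>R d 1"
  proof -
    have "(\<lambda>n. q n *\<^sub>R d 1) \<longlonglongrightarrow> t *\<^sub>R d 1" by (intro tendsto_intros lim)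
    moreover have "d (q n) = q n *\<^sub>R d 1" for n
      using rat q(1) q_nonneg by blast
    ultimately show ?thesis by simp
  qed
  ultimately show ?thesis by (rule LIMSEQ_unique)
qed


context supercyclic_semigroup
begin

text \<open>The map \<open>h\<close> serves both fields at once: the identity for complex-linear
  functionals, \<open>of_real\<close> for complex-valued functionals on a real space. If
  \<open>f x = 0\<close>, then \<open>f\<close> vanishes on the dense projective orbit; if
  \<open>l t = 0\<close>, it vanishes on the dense range of \<open>T t\<close>. Division by
  \<open>f x\<close> then transfers continuity and the semigroup law to \<open>l\<close>.\<close>

lemma eigen_multiplier:
  fixes f :: "'a \<Rightarrow> complex"
  assumes cont: "continuous_on UNIV f" and scal: "\<And>z v. f (scl z v) = h z * f v"
    and eig: "\<forall>t\<ge>0. \<forall>v. f (T t v) = l t * f v" and nz: "f w \<noteq> 0"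
  shows "f x \<noteq> 0" "\<And>t. t \<ge> 0 \<Longrightarrow> l t \<noteq> 0" "continuous_on {0..} l"
    "\<And>s t. s \<ge> 0 \<Longrightarrow> t \<ge> 0 \<Longrightarrow> l (s + t) = l s * l t"
proof -
  show fx: "f x \<noteq> 0"
  proof
    assume "f x = 0"
    have "f w = 0"
    proof (rule orbit_closed_induct[where P = "\<lambda>v. f v = 0"])
      show "closed {v. f v = 0}" using closed_Collect_eq[OF cont, of "\<lambda>_. 0"] by simp
    qed (simp add: scal eig \<open>f x = 0\<close>)
    then show False using nz by simp
  qed
  show "l t \<noteq> 0" if "t \<ge> 0" for t
  proof
    assume "l t = 0"
    then have "f w = 0"
      using comp_T_eq_0[OF cont that, of w] eig that T_zero[OF that]
      by (metis mult_zero_left)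
    then show False using nz by simp
  qed
  have "continuous_on {0..} (\<lambda>t. f (T t x) / f x)"
    using fx by (intro continuous_intros continuous_on_compose2[OF cont continuous_orbit]) auto
  then show "continuous_on {0..} l"
    by (rule continuous_on_eq) (use fx eig in auto)
  show "l (s + t) = l s * l t" if "s \<ge> 0" "t \<ge> 0" for s t
  proof -
    have "l (s + t) * f x = f (T t (T s x))"
      using eig that by (simp add: T_T)
    also have "\<dots> = l s * l t * f x"
      using eig that by simp
    finally show ?thesis using fx by simp
  qed
qed

text \<open>The logarithm \<open>d\<close> of \<open>norm (m t) / norm (l t)\<close> is additive,
  hence linear, so the sign of \<open>d 1\<close> decides on which side of its initial value the
  ratio of \<open>norm (g v)\<close> to \<open>norm (f v)\<close> stays along the orbit.
  Cross-multiplied, this bound is a closed homogeneous condition; it extends to all vectors and puts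
  one kernel inside the other.\<close>

lemma eigen_pair_nested:
  fixes f g :: "'a \<Rightarrow> complex"
  assumes cont: "continuous_on UNIV f" "continuous_on UNIV g"
    and scal: "\<And>z v. f (scl z v) = h z * f v" "\<And>z v. g (scl z v) = h z * g v"
    and eig: "\<forall>t\<ge>0. \<forall>v. f (T t v) = l t * f v"
      "\<forall>t\<ge>0. \<forall>v. g (T t v) = m t * g v"
  shows "(\<forall>v. f v = 0 \<longrightarrow> g v = 0) \<or> (\<forall>v. g v = 0 \<longrightarrow> f v = 0)"
proof (rule ccontr)
  assume *: "\<not> ?thesis"
  then obtain u w where uw: "f u = 0" "g u \<noteq> 0" "g w = 0" "f w \<noteq> 0" by auto
  note F = eigen_multiplier[OF cont(1) scal(1) eig(1) uw(4)]
  note G = eigen_multiplier[OF cont(2) scal(2) eig(2) uw(2)]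
  define d where "d t = ln (norm (m t)) - ln (norm (l t))" for t
  have d: "d t = t *\<^sub>R d 1" if "t \<ge> 0" for t
  proof (rule additive_continuous_linear[OF _ _ that])
    show "d (s + t) = d s + d t" if "s \<ge> 0" "t \<ge> 0" for s t
      using that F G by (simp add: d_def norm_mult ln_mult)
    show "continuous_on {0..} d"
      unfolding d_def by (intro continuous_intros F G) (use F G in auto)
  qed
  show False
  proof (cases "d 1 \<le> 0")
    case True
    have le: "norm (m t) \<le> norm (l t)" if "t \<ge> 0" for t
    proof -
      have "d t \<le> 0" using d[OF that] that True by (simp add: mult_nonneg_nonpos)
      then show ?thesis using F(2)[OF that] G(2)[OF that] by (simp add: d_def)
    qed
    have "norm (g u) * norm (f x) \<le> norm (f u) * norm (g x)"
    proof (rule orbit_closed_induct[where P = "\<lambda>v. norm (g v) * norm (f x) \<le> norm (f v) * norm (g x)"])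
      show "closed {v. norm (g v) * norm (f x) \<le> norm (f v) * norm (g x)}"
        by (intro closed_Collect_le continuous_intros cont)
      show "norm (g (scl z (T t x))) * norm (f x) \<le> norm (f (scl z (T t x))) * norm (g x)"
        if "t \<ge> 0" for z t
        using mult_left_mono[OF le[OF that], of "norm (h z) * norm (f x) * norm (g x)"]
        by (simp add: scal eig that norm_mult mult_ac)
    qed
    then show False using uw F(1) by (simp add: mult_le_0_iff)
  next
    case False
    have le: "norm (l t) \<le> norm (m t)" if "t \<ge> 0" for t
    proof -
      have "d t \<ge> 0" using d[OF that] that False by simp
      then show ?thesis using F(2)[OF that] G(2)[OF that] by (simp add: d_def)
    qed
    have "norm (f w) * norm (g x) \<le> norm (g w) * norm (f x)"
    proof (rule orbit_closed_induct[where P = "\<lambda>v. norm (f v) * norm (g x) \<le> norm (g v) * norm (f x)"])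
      show "closed {v. norm (f v) * norm (g x) \<le> norm (g v) * norm (f x)}"
        by (intro closed_Collect_le continuous_intros cont)
      show "norm (f (scl z (T t x))) * norm (g x) \<le> norm (g (scl z (T t x))) * norm (f x)"
        if "t \<ge> 0" for z t
        using mult_left_mono[OF le[OF that], of "norm (h z) * norm (f x) * norm (g x)"]
        by (simp add: scal eig that norm_mult mult_ac)
    qed
    then show False using uw G(1) by (simp add: mult_le_0_iff)
  qed
qed

text \<open>Along the orbit \<open>g / f\<close> runs through a half-line, but it is onto a full line as soon as
  the kernel of \<open>f\<close> is not contained in that of \<open>g\<close>.\<close>

lemma jordan_pair_nested:
  fixes f g :: "'a \<Rightarrow> complex"
  assumes cont: "continuous_on UNIV f" "continuous_on UNIV g"
    and add: "\<And>u v. f (u + v) = f u + f v" "\<And>u v. g (u + v) = g u + g v"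
    and scal: "\<And>z v. f (scl z v) = h z * f v" "\<And>z v. g (scl z v) = h z * g v"
    and h: "\<And>r. h (of_real r) = of_real r"
    and eig: "\<forall>t\<ge>0. \<forall>v. f (T t v) = l t * f v"
      "\<forall>t\<ge>0. \<forall>v. g (T t v) = l t * g v + a t * f v"
    and nz: "f w \<noteq> 0" and "f v = 0"
  shows "g v = 0"
proof (rule ccontr)
  assume "g v \<noteq> 0"
  note F = eigen_multiplier[OF cont(1) scal(1) eig(1) nz]
  define d where "d t = a t / l t" for t
  have quot: "g (T t x) / f (T t x) = g x / f x + d t" if "t \<ge> 0" for t
    using F(1,2) that by (simp add: eig d_def field_simps)
  have d: "d t = t *\<^sub>R d 1" if "t \<ge> 0" for t
  proof (rule additive_continuous_linear[OF _ _ that])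
    show "d (s + t) = d s + d t" if "s \<ge> 0" "t \<ge> 0" for s t
    proof -
      have "g x / f x + d (s + t) = g (T t (T s x)) / f (T t (T s x))"
        using quot[of "s + t"] that by (simp add: T_T)
      also have "\<dots> = g (T s x) / f (T s x) + d t"
        using F(1,2) that by (simp add: eig d_def field_simps)
      finally show ?thesis using quot[of s] that by simp
    qed
    have "continuous_on {0..} (\<lambda>t. g (T t x) / f (T t x) - g x / f x)"
      using F(1,2) eig(1)
      by (intro continuous_intros continuous_on_compose2[OF cont(1) continuous_orbit]
          continuous_on_compose2[OF cont(2) continuous_orbit]) auto
    then show "continuous_on {0..} d"
      by (rule continuous_on_eq) (use quot in auto)
  qed
  \<comment> \<open>\<open>E v\<close> is \<open>g v / f v - g x / f x\<close> multiplied by the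
    square of \<open>norm (f v)\<close>. Clearing the denominator makes it continuous everywhere,
    and on the orbit it lies in the closed ray \<open>P\<close>.\<close>
  define E where "E v = g v * cnj (f v) - g x / f x * (f v * cnj (f v))" for v
  define P where "P = (\<lambda>r. r *\<^sub>R d 1) ` {0..}"
  have E: "E v \<in> P" for v
  proof (rule orbit_closed_induct[where P = "\<lambda>v. E v \<in> P"])
    have "closed P"
    proof (cases "d 1 = 0")
      case True
      then have "P = {0}" by (auto simp: P_def)
      then show ?thesis by simp
    next
      case False
      then show ?thesis
        unfolding P_def
        by (intro closed_injective_linear_image linear_scaleR_left) (auto intro: injI)
    qed
    moreover have "continuous_on UNIV E"
      unfolding E_def by (intro continuous_intros cont)
    ultimately show "closed {v. E v \<in> P}"
      using closed_vimage[of P E] by (simp add: vimage_def)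
    fix z t assume "t \<ge> (0::real)"
    let ?u = "scl z (T t x)"
    have "g ?u = f ?u * (g x / f x + d t)"
      using F(1,2) \<open>t \<ge> 0\<close> by (simp add: eig scal d_def field_simps)
    then have "E ?u = (f ?u * cnj (f ?u)) * d t"
      by (simp add: E_def algebra_simps)
    also have "\<dots> = ((norm (f ?u))\<^sup>2 * t) *\<^sub>R d 1"
      using d[OF \<open>t \<ge> 0\<close>] complex_norm_square[of "f ?u"] by (simp add: scaleR_conv_of_real)
    finally show "E ?u \<in> P"
      unfolding P_def using \<open>t \<ge> 0\<close> by auto
  qed
  \<comment> \<open>Moving from \<open>x\<close> along \<open>v\<close> leaves \<open>f\<close>
    unchanged, so \<open>E\<close> takes both values \<open>k\<close> and \<open>- k\<close> at
    \<open>x + v\<close> and \<open>x - v\<close>; a ray contains both only if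
    \<open>k = 0\<close>.\<close>
  define k where "k = g v * cnj (f x)"
  have "E (x + scl (of_real r) v) = of_real r * k" for r
    using F(1) \<open>f v = 0\<close> by (simp add: E_def k_def add scal h field_simps)
  then have "k \<in> P" "- k \<in> P"
    using E[of "x + scl (of_real 1) v"] E[of "x + scl (of_real (-1)) v"] by (metis of_real_1 mult_1, metis of_real_1 of_real_minus mult_minus1)
  then obtain r s where rs: "r \<ge> 0" "s \<ge> 0" "k = r *\<^sub>R d 1" "- k = s *\<^sub>R d 1"
    unfolding P_def by auto
  then have "(r + s) *\<^sub>R d 1 = 0" by (metis add.right_inverse scaleR_left.add)
  then have "r + s = 0 \<or> d 1 = 0" by (simp only: scaleR_eq_0_iff)
  then have "k = 0" using rs by (auto simp: add_nonneg_eq_0_iff)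
  then show False using \<open>g v \<noteq> 0\<close> F(1) by (simp add: k_def)
qed

end


section \<open>Curves spanning spaces of small dimension\<close>

lemma (in vector_space) continuum_le_alg_dim:
  fixes e :: "nat set \<Rightarrow> 'b"
  assumes "subspace V" "range e \<subseteq> V" "independent (range e)" "inj e"
  shows "ctwo ^c natLeq \<le>o alg_dim scale V"
proof -
  obtain B where B: "range e \<subseteq> B" "B \<subseteq> V" "independent B" "V \<subseteq> span B"
    using maximal_independent_subset_extend[OF assms(2,3)] by blast
  then have "span B = V"
    using assms(1) span_subspace by blast
  then have dim: "alg_dim scale V =o |B|"
    using B by (intro alg_dim_basis vector_space_axioms) auto
  have "ctwo ^c natLeq =o |Pow (UNIV :: nat set)|"
    using card_of_Pow_Func[of "UNIV :: nat set"] ordIso_symmetric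
    unfolding cexp_def ctwo_def Field_card_of Field_natLeq by blast
  moreover have "|Pow (UNIV :: nat set)| \<le>o |B|"
    using assms(4) B(1) by (intro card_of_ordLeqI[of e]) auto
  ultimately show ?thesis
    using dim ordIso_ordLeq_trans ordLeq_ordIso_trans ordIso_symmetric by blast
qed

text \<open>Indexed, unlike \<open>independent\<close>, so that two equal members count as
  dependent; meant for finite \<open>I\<close>.\<close>

definition independent_family ::
  "('k::field \<Rightarrow> 'v::ab_group_add \<Rightarrow> 'v) \<Rightarrow> 'i set \<Rightarrow> ('i \<Rightarrow> 'v) \<Rightarrow> bool" where
  "independent_family s I v \<longleftrightarrow> (\<forall>c. (\<Sum>i\<in>I. s (c i) (v i)) = 0 \<longrightarrow> (\<forall>i\<in>I. c i = 0))"

lemma bounded_family_convergent_subseq: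
  fixes c :: "nat \<Rightarrow> 'i \<Rightarrow> 'k::heine_borel"
  assumes "finite I" "\<And>i. i \<in> I \<Longrightarrow> bounded (range (\<lambda>k. c k i))"
  shows "\<exists>l r. strict_mono (r :: nat \<Rightarrow> nat) \<and> (\<forall>i\<in>I. (\<lambda>k. c (r k) i) \<longlonglongrightarrow> l i)"
  using assms
proof (induction I)
  case empty
  then show ?case by (auto intro: exI[of _ id] strict_mono_id)
next
  case (insert j I)
  then obtain l r where r: "strict_mono (r :: nat \<Rightarrow> nat)" "\<forall>i\<in>I. (\<lambda>k. c (r k) i) \<longlonglongrightarrow> l i" by auto
  have "bounded (range (\<lambda>k. c (r k) j))"
    using insert.prems[of j] by (auto intro: bounded_subset)
  then obtain m q where q: "strict_mono (q :: nat \<Rightarrow> nat)" "((\<lambda>k. c (r k) j) \<circ> q) \<longlonglongrightarrow> m"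
    using bounded_imp_convergent_subsequence by blast
  have "(\<lambda>k. c ((r \<circ> q) k) i) \<longlonglongrightarrow> (l(j := m)) i" if "i \<in> insert j I" for i
    using that q LIMSEQ_subseq_LIMSEQ[OF r(2)[rule_format] q(1), of i] by (auto simp: o_def)
  then show ?case using strict_mono_o[OF r(1) q(1)] by blast
qed

text \<open>The assumption says that linear relations between points of the curve survive limits of
  the coefficients and of the parameters. It replaces a topology on the vector space.\<close>

locale closed_curve = vector_space s
  for s :: "'k::{real_normed_field,heine_borel} \<Rightarrow> 'v::ab_group_add \<Rightarrow> 'v" +
  fixes f :: "real \<Rightarrow> 'v"
  assumes closed_relation:
    "\<And>(I :: nat set set) c c' t t'.
      finite I \<Longrightarrow> \<forall>i\<in>I. (\<lambda>k. c k i) \<longlonglongrightarrow> c' i \<Longrightarrow>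
      \<forall>i\<in>I. (\<lambda>k. t k i) \<longlonglongrightarrow> t' i \<Longrightarrow> \<forall>k. \<forall>i\<in>I. t k i > 0 \<Longrightarrow> \<forall>i\<in>I. t' i > 0 \<Longrightarrow>
      \<forall>k::nat. (\<Sum>i\<in>I. s (c k i) (f (t k i))) = 0 \<Longrightarrow> (\<Sum>i\<in>I. s (c' i) (f (t' i))) = 0"
begin

text \<open>A compactness argument: dependent parameters tending to \<open>p\<close> carry relations
  whose coefficients can be normalised, and a convergent subsequence of the coefficients yields a
  nontrivial relation at \<open>p\<close>.\<close>

lemma independent_family_open:
  fixes I :: "nat set set"
  assumes I: "finite I" and p: "\<And>i. i \<in> I \<Longrightarrow> p i > 0"
    and ind: "independent_family s I (\<lambda>i. f (p i))"
  shows "\<exists>r>0. \<forall>q. (\<forall>i\<in>I. \<bar>q i - p i\<bar> \<le> r) \<longrightarrow>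
    (\<forall>i\<in>I. q i > 0) \<and> independent_family s I (\<lambda>i. f (q i))"
proof (rule ccontr)
  assume neg: "\<not> ?thesis"
  \<comment> \<open>Half the least parameter, so that all perturbed parameters stay positive; the 1
    covers empty \<open>I\<close>.\<close>
  define R where "R = Min (insert 1 (p ` I)) / 2"
  have "Min (insert 1 (p ` I)) > 0"
    using I p by (subst Min_gr_iff) auto
  moreover have "Min (insert 1 (p ` I)) \<le> p i" if "i \<in> I" for i
    using I that by (intro Min_le) auto
  ultimately have R: "R > 0" "\<And>i. i \<in> I \<Longrightarrow> R < p i"
    unfolding R_def by fastforce+
  define e where "e k = R / real (Suc k)" for k
  have e: "e k > 0" "e k \<le> R" for k
    using R(1) by (auto simp: e_def field_simps)
  \<comment> \<open>The bound on each coefficient gives convergent subsequences; the lower bound on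
    the sum of the norms passes to the limit and keeps it nonzero.\<close>
  define Q where "Q k q c \<longleftrightarrow> (\<forall>i\<in>I. \<bar>q i - p i\<bar> \<le> e k) \<and> (\<Sum>i\<in>I. s (c i) (f (q i))) = 0 \<and>
      (\<forall>i\<in>I. norm (c i) \<le> 1) \<and> (\<Sum>i\<in>I. norm (c i)) \<ge> 1" for k q c
  have "\<exists>q c. Q k q c" for k
  proof -
    obtain q where q: "\<forall>i\<in>I. \<bar>q i - p i\<bar> \<le> e k"
      "\<not> ((\<forall>i\<in>I. q i > 0) \<and> independent_family s I (\<lambda>i. f (q i)))"
      using neg e(1)[of k] by blast
    have "q i > 0" if "i \<in> I" for i
      using q(1) R(2)[OF that] e(2)[of k] that by (smt (verit))
    then have "\<forall>i\<in>I. q i > 0" ..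
    then obtain c j where c: "(\<Sum>i\<in>I. s (c i) (f (q i))) = 0" "j \<in> I" "c j \<noteq> 0"
      using q(2) unfolding independent_family_def by blast
    have "Max ((\<lambda>i. norm (c i)) ` I) \<in> (\<lambda>i. norm (c i)) ` I"
      using I c(2) by (intro Max_in) auto
    then obtain m where m: "m \<in> I" "norm (c m) = Max ((\<lambda>i. norm (c i)) ` I)" by auto
    then have le: "norm (c i) \<le> norm (c m)" if "i \<in> I" for i using that I by simp
    have "c m \<noteq> 0" using le[OF c(2)] c(3) by auto
    define c' where "c' i = c i / c m" for i
    have "(\<Sum>i\<in>I. s (c' i) (f (q i))) = s (inverse (c m)) (\<Sum>i\<in>I. s (c i) (f (q i)))"
      by (simp add: scale_sum_right c'_def divide_inverse mult.commute)
    moreover have "norm (c' i) \<le> 1" if "i \<in> I" for i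
      using le[OF that] \<open>c m \<noteq> 0\<close> by (simp add: c'_def norm_divide)
    moreover have "norm (c' m) \<le> (\<Sum>i\<in>I. norm (c' i))"
      using I m(1) by (intro member_le_sum) auto
    ultimately show ?thesis
      using q(1) c(1) \<open>c m \<noteq> 0\<close> unfolding Q_def
      by (intro exI[of _ q] exI[of _ c']) (simp_all add: c'_def)
  qed
  then obtain q c where "\<And>k. Q k (q k) (c k)" by metis
  then have qc: "\<And>k i. i \<in> I \<Longrightarrow> \<bar>q k i - p i\<bar> \<le> e k"
    "\<And>k. (\<Sum>i\<in>I. s (c k i) (f (q k i))) = 0" "\<And>k i. i \<in> I \<Longrightarrow> norm (c k i) \<le> 1"
    "\<And>k. (\<Sum>i\<in>I. norm (c k i)) \<ge> 1"
    unfolding Q_def by blast+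
  have "bounded (range (\<lambda>k. c k i))" if "i \<in> I" for i
    using qc(3)[OF that] by (auto simp: bounded_iff)
  then obtain l r where r: "strict_mono (r :: nat \<Rightarrow> nat)"
    and l: "\<forall>i\<in>I. (\<lambda>k. c (r k) i) \<longlonglongrightarrow> l i"
    using bounded_family_convergent_subseq[OF I] by metis
  have e0: "e \<longlonglongrightarrow> 0"
    unfolding e_def by (rule LIMSEQ_Suc) (rule lim_const_over_n)
  have "(\<lambda>k. e (r k)) \<longlonglongrightarrow> 0" using LIMSEQ_subseq_LIMSEQ[OF e0 r] by (simp add: o_def)
  then have q: "(\<lambda>k. q (r k) i) \<longlonglongrightarrow> p i" if "i \<in> I" for i
  proof -
    have "(\<lambda>k. q (r k) i - p i) \<longlonglongrightarrow> 0"
      by (rule Lim_null_comparison[OF _ \<open>(\<lambda>k. e (r k)) \<longlonglongrightarrow> 0\<close>])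
        (simp add: qc(1)[OF that])
    then show ?thesis by (rule LIM_zero_cancel)
  qed
  have "q k i > 0" if "i \<in> I" for k i
    using qc(1)[OF that, of k] e(2)[of k] R(2)[OF that] by linarith
  then have "(\<Sum>i\<in>I. s (l i) (f (p i))) = 0"
    by (intro closed_relation[OF I l, of "\<lambda>k i. q (r k) i"]) (use q p qc(2) in auto)
  then have "\<forall>i\<in>I. l i = 0" using ind unfolding independent_family_def by blast
  moreover have "(\<lambda>k. \<Sum>i\<in>I. norm (c (r k) i)) \<longlonglongrightarrow> (\<Sum>i\<in>I. norm (l i))"
    using l by (intro tendsto_intros) auto
  then have "(\<Sum>i\<in>I. norm (l i)) \<ge> 1"
    by (rule LIMSEQ_le_const) (use qc(4) in blast)
  ultimately have "(\<Sum>i\<in>I. norm (l i)) = 0" "(\<Sum>i\<in>I. norm (l i)) \<ge> 1" by simp_all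
  then show False by linarith
qed

text \<open>The points are chosen one at a time: the arc over \<open>(p j, p j + r)\<close> leaves
  the finite-dimensional span of the points already chosen.\<close>

lemma independent_family_dense:
  fixes I :: "nat set set"
  assumes infdim: "\<forall>a b F. 0 < a \<longrightarrow> a < b \<longrightarrow> finite F \<longrightarrow> \<not> f ` {a<..<b} \<subseteq> span F"
    and I: "finite I" and p: "\<And>i. i \<in> I \<Longrightarrow> p i > 0" and "r > 0"
  shows "\<exists>q. (\<forall>i\<in>I. q i > 0 \<and> \<bar>q i - p i\<bar> \<le> r) \<and> independent_family s I (\<lambda>i. f (q i))"
  using I p
proof (induction I)
  case empty
  then show ?case by (simp add: independent_family_def)
next
  case (insert j I)
  then obtain q where q: "\<forall>i\<in>I. q i > 0 \<and> \<bar>q i - p i\<bar> \<le> r"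
    "independent_family s I (\<lambda>i. f (q i))" by auto
  obtain t where t: "p j < t" "t < p j + r" "f t \<notin> span ((\<lambda>i. f (q i)) ` I)"
    using infdim[rule_format, of "p j" "p j + r" "(\<lambda>i. f (q i)) ` I"] insert.prems[of j] insert.hyps \<open>r > 0\<close>
    by (auto simp: image_subset_iff)
  define q' where "q' = q(j := t)"
  have q'I: "(\<Sum>i\<in>I. s (c i) (f (q' i))) = (\<Sum>i\<in>I. s (c i) (f (q i)))" for c
    using insert.hyps by (intro sum.cong) (auto simp: q'_def)
  have "independent_family s (insert j I) (\<lambda>i. f (q' i))"
    unfolding independent_family_def
  proof (intro allI impI)
    fix c assume "(\<Sum>i\<in>insert j I. s (c i) (f (q' i))) = 0"
    then have sum: "s (c j) (f t) + (\<Sum>i\<in>I. s (c i) (f (q i))) = 0"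
      using insert.hyps q'I[of c] by (simp add: q'_def)
    have "c j = 0"
    proof (rule ccontr)
      assume "c j \<noteq> 0"
      then have "f t = s (inverse (c j)) (s (c j) (f t))" by simp
      also have "s (c j) (f t) = - (\<Sum>i\<in>I. s (c i) (f (q i)))"
        using sum by (simp add: eq_neg_iff_add_eq_0)
      finally have "f t = s (inverse (c j)) (- (\<Sum>i\<in>I. s (c i) (f (q i))))" .
      also have "\<dots> \<in> span ((\<lambda>i. f (q i)) ` I)"
        by (intro span_scale span_neg span_sum) (auto intro: span_base)
      finally show False using t by simp
    qed
    with sum q(2) show "\<forall>i\<in>insert j I. c i = 0"
      by (simp add: independent_family_def)
  qed
  moreover have "\<forall>i\<in>insert j I. q' i > 0 \<and> \<bar>q' i - p i\<bar> \<le> r"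
    using q(1) t insert.prems[of j] by (auto simp: q'_def)
  ultimately show ?case by blast
qed

text \<open>\<open>fst pr\<close> holds the centres and \<open>snd pr\<close> the common radius of
  the closed intervals of level \<open>n\<close>. The condition is on every selection
  \<open>q\<close>, so that it applies to limit points of the scheme.\<close>

definition separated :: "nat \<Rightarrow> (nat set \<Rightarrow> real) \<times> real \<Rightarrow> bool" where
  "separated n pr \<longleftrightarrow> snd pr > 0 \<and> (\<forall>q. (\<forall>S\<in>Pow {..<n}. \<bar>q S - fst pr S\<bar> \<le> snd pr) \<longrightarrow>
     (\<forall>S\<in>Pow {..<n}. q S > 0) \<and> independent_family s (Pow {..<n}) (\<lambda>S. f (q S)))"

text \<open>A Cantor scheme: the intervals of level \<open>n\<close> are indexed by the subsets of \<open>{..<n}\<close>, and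
  any choice of one parameter from each of them gives independent points of the curve.\<close>

lemma separated_scheme:
  assumes infdim: "\<forall>a b F. 0 < a \<longrightarrow> a < b \<longrightarrow> finite F \<longrightarrow> \<not> f ` {a<..<b} \<subseteq> span F"
  obtains p :: "nat \<Rightarrow> nat set \<Rightarrow> real" and r :: "nat \<Rightarrow> real"
  where "\<And>n. separated n (p n, r n)" "\<And>n. r (Suc n) \<le> r n / 2"
    "\<And>n S. S \<subseteq> {..<Suc n} \<Longrightarrow> \<bar>p (Suc n) S - p n (S \<inter> {..<n})\<bar> \<le> r n / 2"
proof -
  have "\<exists>pr. \<forall>n. separated n (pr n) \<and> (snd (pr (Suc n)) \<le> snd (pr n) / 2 \<and>
      (\<forall>S\<in>Pow {..<Suc n}. \<bar>fst (pr (Suc n)) S - fst (pr n) (S \<inter> {..<n})\<bar> \<le> snd (pr n) / 2))"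
  proof (rule dependent_nat_choice)
    have "\<exists>q. (\<forall>i\<in>{{} :: nat set}. q i > 0 \<and> \<bar>q i - 1\<bar> \<le> 1) \<and>
        independent_family s {{} :: nat set} (\<lambda>i. f (q i))"
      by (rule independent_family_dense[OF infdim]) auto
    then obtain q where q: "\<forall>i\<in>{{} :: nat set}. q i > 0"
      "independent_family s {{} :: nat set} (\<lambda>i. f (q i))" by blast
    obtain r where "r > 0" "\<forall>q'. (\<forall>i\<in>{{} :: nat set}. \<bar>q' i - q i\<bar> \<le> r) \<longrightarrow>
        (\<forall>i\<in>{{} :: nat set}. q' i > 0) \<and> independent_family s {{} :: nat set} (\<lambda>i. f (q' i))"
      using independent_family_open[OF _ _ q(2)] q(1) by auto
    then have "separated 0 (q, r)" by (auto simp: separated_def)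
    then show "\<exists>pr. separated 0 pr" ..
  next
    fix pr n assume "separated n pr"
    obtain p r where pr: "pr = (p, r)" by (cases pr)
    with \<open>separated n pr\<close> have r: "r > 0" and p: "\<And>S. S \<subseteq> {..<n} \<Longrightarrow> p S > 0"
      by (auto simp: separated_def)
    let ?I = "Pow {..<Suc n}"
    have "\<exists>q. (\<forall>S\<in>?I. q S > 0 \<and> \<bar>q S - p (S \<inter> {..<n})\<bar> \<le> r / 2) \<and>
        independent_family s ?I (\<lambda>S. f (q S))"
      by (rule independent_family_dense[OF infdim]) (use r p in auto)
    then obtain q where q: "\<forall>S\<in>?I. q S > 0 \<and> \<bar>q S - p (S \<inter> {..<n})\<bar> \<le> r / 2"
      "independent_family s ?I (\<lambda>S. f (q S))" by blast
    obtain \<rho> where \<rho>: "\<rho> > 0" "\<forall>q'. (\<forall>S\<in>?I. \<bar>q' S - q S\<bar> \<le> \<rho>) \<longrightarrow>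
        (\<forall>S\<in>?I. q' S > 0) \<and> independent_family s ?I (\<lambda>S. f (q' S))"
      using independent_family_open[OF _ _ q(2)] q(1) by auto
    \<comment> \<open>The new centres are within \<open>r / 2\<close> of the old ones, so radius at
      most \<open>r / 2\<close> nests each interval in its parent.\<close>
    have "separated (Suc n) (q, min \<rho> (r / 2))"
      using \<rho> r unfolding separated_def by simp
    then show "\<exists>pr'. separated (Suc n) pr' \<and> (snd pr' \<le> snd pr / 2 \<and>
        (\<forall>S\<in>?I. \<bar>fst pr' S - fst pr (S \<inter> {..<n})\<bar> \<le> snd pr / 2))"
      using q(1) pr by (intro exI[of _ "(q, min \<rho> (r / 2))"]) auto
  qed
  then obtain pr where pr: "\<And>n. separated n (pr n)" "\<And>n. snd (pr (Suc n)) \<le> snd (pr n) / 2"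
    "\<And>n S. S \<subseteq> {..<Suc n} \<Longrightarrow> \<bar>fst (pr (Suc n)) S - fst (pr n) (S \<inter> {..<n})\<bar> \<le> snd (pr n) / 2"
    by blast
  then show ?thesis
    by (intro that[of "\<lambda>n. fst (pr n)" "\<lambda>n. snd (pr n)"]) auto
qed

lemma inj_on_Int_lessThan:
  fixes \<S> :: "nat set set"
  assumes "finite \<S>"
  obtains n where "inj_on (\<lambda>S. S \<inter> {..<n}) \<S>"
proof -
  define d where "d p = (SOME k. (k \<in> fst p) \<noteq> (k \<in> (snd p :: nat set)))" for p
  have "finite (d ` (\<S> \<times> \<S>))" using assms by simp
  then obtain n where n: "\<forall>k\<in>d ` (\<S> \<times> \<S>). k < n"
    using finite_nat_set_iff_bounded by auto
  have "inj_on (\<lambda>S. S \<inter> {..<n}) \<S>"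
  proof (rule inj_onI, rule ccontr)
    fix A B assume AB: "A \<in> \<S>" "B \<in> \<S>" "A \<inter> {..<n} = B \<inter> {..<n}" "A \<noteq> B"
    then have "\<exists>k. (k \<in> A) \<noteq> (k \<in> B)" by auto
    then have "(d (A, B) \<in> A) \<noteq> (d (A, B) \<in> B)"
      unfolding d_def fst_conv snd_conv by (rule someI_ex)
    moreover have "d (A, B) < n" using n AB by auto
    ultimately show False using AB(3) by auto
  qed
  then show ?thesis by (rule that)
qed

text \<open>A set \<open>S\<close> is a branch through the intervals indexed by its traces on
  \<open>{..<n}\<close>, and \<open>g S\<close> is a point common to them. Finitely many branches
  have distinct traces at some level \<open>n\<close>, where \<open>separated\<close> makes their
  points independent.\<close>

lemma perfect_independent:
  assumes infdim: "\<forall>a b F. 0 < a \<longrightarrow> a < b \<longrightarrow> finite F \<longrightarrow> \<not> f ` {a<..<b} \<subseteq> span F"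
  shows "\<exists>g :: nat set \<Rightarrow> real. (\<forall>S. g S > 0) \<and> inj (\<lambda>S. f (g S)) \<and>
    independent (range (\<lambda>S. f (g S)))"
proof -
  obtain p :: "nat \<Rightarrow> nat set \<Rightarrow> real" and r where sep: "\<And>n. separated n (p n, r n)"
    and r: "\<And>n. r (Suc n) \<le> r n / 2"
    and p: "\<And>n S. S \<subseteq> {..<Suc n} \<Longrightarrow> \<bar>p (Suc n) S - p n (S \<inter> {..<n})\<bar> \<le> r n / 2"
    using separated_scheme[OF infdim] by metis
  define P where "P S n = p n (S \<inter> {..<n})" for S n
  have P: "\<bar>P S (Suc n) - P S n\<bar> \<le> r n / 2" for S n
  proof -
    have "S \<inter> {..<Suc n} \<inter> {..<n} = S \<inter> {..<n}" by auto
    then show ?thesis using p[of "S \<inter> {..<Suc n}" n] by (simp add: P_def)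
  qed
  have rpos: "r n > 0" for n using sep[of n] by (simp add: separated_def)
  have inc: "incseq (\<lambda>n. P S n - r n)" and dec: "decseq (\<lambda>n. P S n + r n)" for S
  proof -
    have "P S n - r n \<le> P S (Suc n) - r (Suc n)" "P S (Suc n) + r (Suc n) \<le> P S n + r n" for n
      using P[of S n] r[of n] by linarith+
    then show "incseq (\<lambda>n. P S n - r n)" "decseq (\<lambda>n. P S n + r n)"
      by (auto intro: incseq_SucI decseq_SucI)
  qed
  have lohi: "P S n - r n \<le> P S m + r m" for S n m
  proof -
    have "P S n - r n \<le> P S (max n m) - r (max n m)" using inc[of S] by (simp add: incseq_def)
    also have "\<dots> \<le> P S (max n m) + r (max n m)" using rpos[of "max n m"] by simp
    also have "\<dots> \<le> P S m + r m" using dec[of S] by (simp add: decseq_def)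
    finally show ?thesis .
  qed
  \<comment> \<open>The supremum of the left endpoints; by \<open>lohi\<close> no right endpoint
    lies below it.\<close>
  define g where "g S = (SUP n. P S n - r n)" for S
  have g: "\<bar>g S - P S n\<bar> \<le> r n" for S n
  proof -
    have "P S n - r n \<le> g S"
      unfolding g_def using lohi[of S _ 0] by (intro cSUP_upper bdd_aboveI[of _ "P S 0 + r 0"]) auto
    moreover have "g S \<le> P S n + r n"
      unfolding g_def using lohi by (intro cSUP_least) auto
    ultimately show ?thesis by linarith
  qed
  have gpos: "g S > 0" for S
  proof -
    have "\<forall>U\<in>Pow {..<0}. \<bar>g S - p 0 U\<bar> \<le> r 0" using g[of S 0] by (simp add: P_def)
    then show ?thesis
      using conjunct2[OF sep[of 0, unfolded separated_def fst_conv snd_conv], THEN spec, of "\<lambda>_. g S"]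
      by simp
  qed
  have ind: "independent_family s \<S> (\<lambda>S. f (g S))" if "finite \<S>" for \<S>
    unfolding independent_family_def
  proof (intro allI impI)
    fix c assume c: "(\<Sum>S\<in>\<S>. s (c S) (f (g S))) = 0"
    obtain n where inj: "inj_on (\<lambda>S. S \<inter> {..<n}) \<S>"
      using inj_on_Int_lessThan[OF \<open>finite \<S>\<close>] .
    let ?J = "(\<lambda>S. S \<inter> {..<n}) ` \<S>"
    let ?v = "inv_into \<S> (\<lambda>S. S \<inter> {..<n})"
    have v: "?v (S \<inter> {..<n}) = S" if "S \<in> \<S>" for S
      using inv_into_f_f[OF inj that] by simp
    \<comment> \<open>Intervals met by no branch of \<S> are represented by their centres, with
      coefficient 0 in \<open>c'\<close>.\<close>
    define q where "q U = (if U \<in> ?J then g (?v U) else p n U)" for U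
    have "\<bar>q U - p n U\<bar> \<le> r n" if "U \<subseteq> {..<n}" for U
      using g[of _ n] v rpos[of n] by (auto simp: q_def P_def)
    then have indq: "independent_family s (Pow {..<n}) (\<lambda>U. f (q U))"
      using sep[of n] by (simp add: separated_def)
    define c' where "c' U = (if U \<in> ?J then c (?v U) else 0)" for U
    have "(\<Sum>U\<in>Pow {..<n}. s (c' U) (f (q U))) = (\<Sum>U\<in>?J. s (c' U) (f (q U)))"
      by (intro sum.mono_neutral_right) (auto simp: c'_def)
    also have "\<dots> = (\<Sum>S\<in>\<S>. s (c S) (f (g S)))"
      by (subst sum.reindex[OF inj], intro sum.cong) (auto simp: c'_def q_def v)
    finally have "\<forall>U\<in>Pow {..<n}. c' U = 0"
      using c indq unfolding independent_family_def by metis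
    moreover have "c' (S \<inter> {..<n}) = c S" if "S \<in> \<S>" for S
      using that v[OF that] by (simp add: c'_def)
    ultimately show "\<forall>S\<in>\<S>. c S = 0" by (metis Int_lower2 PowI)
  qed
  have inj: "inj (\<lambda>S. f (g S))"
  proof (rule injI, rule ccontr)
    fix A B assume eq: "f (g A) = f (g B)" and "A \<noteq> B"
    have "(\<Sum>S\<in>{A, B}. s (if S = A then 1 else - 1) (f (g S))) = 0"
      using \<open>A \<noteq> B\<close> eq by simp
    then show False
      using ind[of "{A, B}", unfolded independent_family_def, THEN spec,
          of "\<lambda>S. if S = A then 1 else - 1"] by simp
  qed
  have "independent (range (\<lambda>S. f (g S)))"
    unfolding independent_explicit_finite_subsets
  proof (intro allI impI ballI)
    fix A u v assume A: "A \<subseteq> range (\<lambda>S. f (g S))" "finite A" "(\<Sum>v\<in>A. s (u v) v) = 0" "v \<in> A"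
    obtain \<S> where \<S>: "finite \<S>" "A = (\<lambda>S. f (g S)) ` \<S>"
      using finite_subset_image[OF A(2,1)] by auto
    have "(\<Sum>S\<in>\<S>. s (u (f (g S))) (f (g S))) = 0"
      using A(3) sum.reindex[OF inj_on_subset[OF inj], of \<S> "\<lambda>v. s (u v) v"] \<S>(2) by (simp add: o_def)
    then show "u v = 0"
      using ind[OF \<S>(1), unfolded independent_family_def, THEN spec, of "\<lambda>S. u (f (g S))"] A(4) \<S>(2)
      by auto
  qed
  with inj gpos show ?thesis by blast
qed

end


section \<open>From an arc in a finite-dimensional subspace to an invariant subspace\<close>

lemma (in vector_space) dim_less_subspace:
  assumes "subspace A" "A \<subset> B" "B \<subseteq> span F" "finite F"
  shows "dim A < dim B"
proof -
  obtain a where a: "a \<subseteq> A" "independent a" "A \<subseteq> span a"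
    using maximal_independent_subset[of A] by blast
  then have "span a = A" using assms(1) span_subspace by blast
  obtain v where v: "v \<in> B" "v \<notin> A" using assms(2) by blast
  then have "independent (insert v a)"
    using a \<open>span a = A\<close> by (intro independent_insertI) auto
  moreover have "insert v a \<subseteq> B" using a v assms(2) by auto
  ultimately obtain b where b: "insert v a \<subseteq> b" "b \<subseteq> B" "independent b" "B \<subseteq> span b"
    using maximal_independent_subset_extend by metis
  have "finite b"
    using independent_span_bound[OF assms(4) b(3)] b(2) assms(3) by auto
  have "v \<notin> a" using a v by auto
  have "dim A = card a" using basis_card_eq_dim[OF a(1,3,2)] by simp
  also have "\<dots> < card (insert v a)"
    using \<open>v \<notin> a\<close> b(1) \<open>finite b\<close> finite_subset by (subst card_insert_disjoint) auto
  also have "\<dots> \<le> card b" using b(1) \<open>finite b\<close> by (rule card_mono[rotated])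
  also have "\<dots> = dim B" using basis_card_eq_dim[OF b(2,4,3)] by simp
  finally show ?thesis .
qed

text \<open>Among the subintervals of \<open>(a, b)\<close>, take one whose arc spans a space
  \<open>L\<close> of least dimension. Its left half then spans \<open>L\<close> too. A shift by
  half the length keeps that half inside the interval, so \<open>L\<close> is invariant under this
  shift and catches the whole later curve; invariance under every \<open>S t\<close>
  follows.\<close>

lemma (in vector_space) eventually_invariant_span:
  fixes S :: "real \<Rightarrow> 'b \<Rightarrow> 'b"
  assumes lin: "\<And>t. t \<ge> 0 \<Longrightarrow> Vector_Spaces.linear scale scale (S t)"
    and shift: "\<And>t u. t \<ge> 0 \<Longrightarrow> u > 0 \<Longrightarrow> S t (f u) = f (t + u)"
    and fin: "0 < a" "a < b" "finite F" "f ` {a<..<b} \<subseteq> span F"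
  obtains c G where "c > 0" "finite G" "G \<subseteq> f ` {0<..}" "\<And>t. t \<ge> c \<Longrightarrow> f t \<in> span G"
    "\<And>t v. t \<ge> 0 \<Longrightarrow> v \<in> span G \<Longrightarrow> S t v \<in> span G"
proof -
  define W where "W p = span (f ` {fst p<..<snd p})" for p :: "real \<times> real"
  define ok where "ok p \<longleftrightarrow> a \<le> fst p \<and> fst p < snd p \<and> snd p \<le> b" for p :: "real \<times> real"
  have "ok (a, b)" using fin by (simp add: ok_def)
  then obtain p where p: "ok p" "\<And>q. ok q \<Longrightarrow> dim (W p) \<le> dim (W q)"
    using ex_has_least_nat[of ok "(a, b)" "\<lambda>p. dim (W p)"] by blast
  obtain a' b' where p': "p = (a', b')" by (cases p)
  have ab: "a \<le> a'" "a' < b'" "b' \<le> b" using p(1) by (auto simp: ok_def p')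
  define L where "L = span (f ` {a'<..<b'})"
  have L_le: "L \<subseteq> span F"
    unfolding L_def using fin ab
    by (intro span_minimal subspace_span) (auto simp: image_subset_iff)
  define m where "m = (a' + b') / 2"
  have m: "a' < m" "m < b'" using ab by (auto simp: m_def)
  have "span (f ` {a'<..<m}) = L"
  proof (rule ccontr)
    assume "span (f ` {a'<..<m}) \<noteq> L"
    moreover have "span (f ` {a'<..<m}) \<subseteq> L"
      unfolding L_def using m by (intro span_mono image_mono) auto
    ultimately have "dim (span (f ` {a'<..<m})) < dim L"
      using L_le fin(3) by (intro dim_less_subspace) auto
    moreover have "ok (a', m)" using ab m by (auto simp: ok_def)
    ultimately show False using p(2)[of "(a', m)"] by (simp add: W_def L_def p')
  qed
  define d where "d = b' - m"
  have d: "d > 0" using m by (simp add: d_def)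
  have Sd: "S d v \<in> L" if "v \<in> L" for v
  proof -
    interpret S: Vector_Spaces.linear scale scale "S d" using lin d by simp
    have "v \<in> span (f ` {a'<..<m})" using that \<open>span (f ` {a'<..<m}) = L\<close> by simp
    then have "S d v \<in> span (S d ` f ` {a'<..<m})" by (simp add: S.span_image)
    also have "S d ` f ` {a'<..<m} \<subseteq> f ` {a'<..<b'}"
      using shift[of d] d ab fin by (auto simp: d_def intro!: image_eqI[of _ _ "d + _"])
    then have "span (S d ` f ` {a'<..<m}) \<subseteq> L" unfolding L_def by (rule span_mono)
    finally show ?thesis .
  qed
  have step: "f v \<in> L" if "a' < v" "v < b' + real n * d" for n v
    using that
  proof (induction n arbitrary: v)
    case 0
    then show ?case unfolding L_def by (auto intro: span_base)
  next
    case (Suc n)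
    show ?case
    proof (cases "v < b'")
      case True
      then show ?thesis unfolding L_def using Suc.prems by (auto intro: span_base)
    next
      case False
      then have "a' < v - d" "v - d < b' + real n * d"
        using m Suc.prems by (auto simp: d_def algebra_simps)
      then have "f (v - d) \<in> L" by (rule Suc.IH)
      then have "S d (f (v - d)) \<in> L" by (rule Sd)
      then show ?thesis
        using shift[of d "v - d"] d \<open>a' < v - d\<close> ab fin by simp
    qed
  qed
  have all: "f v \<in> L" if "a' < v" for v
  proof -
    obtain n where "v - b' < real n * d" using d ex_less_of_nat_mult by blast
    then show ?thesis using step[of v n] that by simp
  qed
  have SL: "S t v \<in> L" if "t \<ge> 0" "v \<in> L" for t v
  proof -
    interpret S: Vector_Spaces.linear scale scale "S t" using lin that by simp
    have "S t v \<in> span (S t ` f ` {a'<..<b'})"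
      using that(2) unfolding L_def by (simp add: S.span_image)
    also have "S t ` f ` {a'<..<b'} \<subseteq> L"
      using shift[of t] that(1) ab fin all by auto
    then have "span (S t ` f ` {a'<..<b'}) \<subseteq> L"
      unfolding L_def by (intro span_minimal subspace_span)
    finally show ?thesis .
  qed
  obtain G where G: "G \<subseteq> f ` {a'<..<b'}" "independent G" "f ` {a'<..<b'} \<subseteq> span G"
    using maximal_independent_subset[of "f ` {a'<..<b'}"] by blast
  have "span G = L"
    unfolding L_def using G by (metis span_mono span_span subset_antisym)
  moreover have "finite G"
    using independent_span_bound[OF fin(3) G(2)] G(1) L_le span_base unfolding L_def by blast
  moreover have "G \<subseteq> f ` {0<..}" using G(1) ab fin by auto
  ultimately show ?thesis
    using ab fin all SL by (intro that[of b' G]) auto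
qed

lemma small_dim_eventually_invariant:
  fixes S :: "real \<Rightarrow> 'v::ab_group_add \<Rightarrow> 'v"
  assumes curve: "closed_curve s f"
    and V: "module.subspace s V" "f ` {0<..} \<subseteq> V" and small: "alg_dim s V <o ctwo ^c natLeq"
    and lin: "\<And>t. t \<ge> 0 \<Longrightarrow> Vector_Spaces.linear s s (S t)"
    and shift: "\<And>t u. t \<ge> 0 \<Longrightarrow> u > 0 \<Longrightarrow> S t (f u) = f (t + u)"
  obtains c G where "c > 0" "finite G" "G \<subseteq> f ` {0<..}" "\<And>t. t \<ge> c \<Longrightarrow> f t \<in> module.span s G"
    "\<And>t v. t \<ge> 0 \<Longrightarrow> v \<in> module.span s G \<Longrightarrow> S t v \<in> module.span s G"
proof -
  interpret closed_curve s f by fact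
  have "\<not> (\<forall>a b F. 0 < a \<longrightarrow> a < b \<longrightarrow> finite F \<longrightarrow> \<not> f ` {a<..<b} \<subseteq> span F)"
  proof
    assume "\<forall>a b F. 0 < a \<longrightarrow> a < b \<longrightarrow> finite F \<longrightarrow> \<not> f ` {a<..<b} \<subseteq> span F"
    then obtain g :: "nat set \<Rightarrow> real" where g: "\<forall>S. g S > 0" "inj (\<lambda>S. f (g S))"
      "independent (range (\<lambda>S. f (g S)))"
      using perfect_independent by blast
    then have "ctwo ^c natLeq \<le>o alg_dim s V"
      using V by (intro continuum_le_alg_dim[of V "\<lambda>S. f (g S)"]) auto
    with small show False using not_ordLess_ordLeq by blast
  qed
  then show ?thesis
    using eventually_invariant_span[of S f] lin shift that by metis
qed


section \<open>Common eigenvectors modulo an invariant subspace\<close>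

context vector_space
begin

lemma annihilating_polynomial:
  assumes "finite F" "\<And>i. x i \<in> span F"
  obtains p :: "'a poly" where "p \<noteq> 0" "degree p \<le> card F"
    "(\<Sum>i\<le>card F. scale (coeff p i) (x i)) = 0"
proof -
  let ?N = "card F"
  have "\<exists>c. (\<exists>i\<le>?N. c i \<noteq> 0) \<and> (\<Sum>i\<le>?N. scale (c i) (x i)) = 0"
  proof (cases "inj_on x {..?N}")
    case True
    have "dependent (x ` {..?N})"
    proof (rule ccontr)
      assume "independent (x ` {..?N})"
      then have "card (x ` {..?N}) \<le> ?N"
        using independent_span_bound[OF assms(1)] assms(2) by blast
      then show False using card_image[OF True] by simp
    qed
    then obtain u v where u: "v \<in> x ` {..?N}" "u v \<noteq> 0" "(\<Sum>v\<in>x ` {..?N}. scale (u v) v) = 0"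
      using dependent_finite[of "x ` {..?N}"] by auto
    then show ?thesis
      using True by (intro exI[of _ "u \<circ> x"]) (auto simp: sum.reindex)
  next
    case False
    then obtain i j where ij: "i \<le> ?N" "j \<le> ?N" "i \<noteq> j" "x i = x j" by (auto simp: inj_on_def)
    \<comment> \<open>\<open>dependent\<close> is about sets and does not see a repeated vector, so
      the relation is written down.\<close>
    define c where "c k = (if k = i then 1 else if k = j then - 1 else 0 :: 'a)" for k
    have "(\<Sum>k\<le>?N. scale (c k) (x k)) = (\<Sum>k\<in>{i, j}. scale (c k) (x k))"
      using ij by (intro sum.mono_neutral_right) (auto simp: c_def)
    also have "\<dots> = 0" using ij by (simp add: c_def)
    finally show ?thesis using ij by (intro exI[of _ c]) (auto simp: c_def)
  qed
  then obtain c j where c: "j \<le> ?N" "c j \<noteq> 0" "(\<Sum>i\<le>?N. scale (c i) (x i)) = 0" by auto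
  define p where "p = (\<Sum>i\<le>?N. monom (c i) i)"
  have co: "coeff p i = (if i \<le> ?N then c i else 0)" for i
    by (simp add: p_def coeff_sum coeff_monom sum.delta' if_distrib cong: if_cong)
  show ?thesis
  proof (rule that[of p])
    show "p \<noteq> 0" using co[of j] c by auto
    show "degree p \<le> ?N" by (rule degree_le) (simp add: co)
  qed (use c(3) in \<open>simp add: co\<close>)
qed

end

locale complex_vector_space = vector_space s
  for s :: "complex \<Rightarrow> 'v::ab_group_add \<Rightarrow> 'v"
begin

text \<open>The minimal polynomial argument modulo \<open>P\<close>: if \<open>p\<close> has least
  degree among nonzero polynomials with \<open>p(A) v\<close> in \<open>P\<close>, it is not
  constant, and removing a linear factor with root \<open>z\<close> gives \<open>q\<close> with
  \<open>w = q(A) v\<close> outside \<open>P\<close>.\<close>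

lemma eigenvector_mod:
  assumes lin: "Vector_Spaces.linear s s A"
    and P: "subspace P" and Q: "subspace Q" "\<And>v. v \<in> Q \<Longrightarrow> A v \<in> Q"
    and fin: "finite F" "Q \<subseteq> span F" and v: "v \<in> Q" "v \<notin> P"
  obtains w z where "w \<in> Q" "w \<notin> P" "A w - s z w \<in> P"
proof -
  interpret A: Vector_Spaces.linear s s A by fact
  have pow: "(A ^^ i) v \<in> Q" for i using v Q by (induction i) auto
  \<comment> \<open>This is \<open>p(A) v\<close>, summed up to the fixed bound
    \<open>card F\<close> in place of the degree.\<close>
  define act where "act p = (\<Sum>i\<le>card F. s (coeff p i) ((A ^^ i) v))" for p
  define ok where "ok p \<longleftrightarrow> p \<noteq> 0 \<and> degree p \<le> card F \<and> act p \<in> P" for p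
  obtain p0 where "ok p0"
    using annihilating_polynomial[OF fin(1), of "\<lambda>i. (A ^^ i) v"] pow fin(2) subspace_0[OF P]
    unfolding ok_def act_def by (metis subsetD)
  then obtain p where p: "ok p" "\<And>q. ok q \<Longrightarrow> degree p \<le> degree q"
    using ex_has_least_nat[of ok p0 degree] by blast
  have "degree p \<noteq> 0"
  proof
    assume "degree p = 0"
    then obtain c where c: "p = [:c:]" by (metis degree_eq_zeroE)
    then have "act p = s c v"
      unfolding act_def by (subst sum.remove[of _ 0]) (auto intro!: sum.neutral simp: coeff_pCons split: nat.splits)
    then have "s c v \<in> P" using p(1) by (simp add: ok_def)
    then have "s (inverse c) (s c v) \<in> P" by (rule subspace_scale[OF P])
    then show False using c p(1) v by (simp add: ok_def)
  qed
  then obtain N where N: "card F = Suc N" using p(1) by (cases "card F") (auto simp: ok_def)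
  obtain z where "poly p z = 0"
    using fundamental_theorem_of_algebra[of p] \<open>degree p \<noteq> 0\<close> by (auto simp: constant_degree)
  then obtain q where q: "p = [:- z, 1:] * q" by (metis dvdE poly_eq_0_iff_dvd)
  then have q0: "q \<noteq> 0" using p(1) by (auto simp: ok_def)
  have dq: "degree p = Suc (degree q)"
    unfolding q by (subst degree_mult_eq) (use q0 in auto)
  have "act q \<notin> P"
    using p q0 dq unfolding ok_def by (metis Suc_leD not_less_eq_eq order_refl)
  moreover have "act q \<in> Q"
    unfolding act_def by (intro subspace_sum[OF Q(1)] subspace_scale[OF Q(1)] pow)
  moreover have "A (act q) - s z (act q) = act p"
  proof -
    \<comment> \<open>The top coefficient vanishes because \<open>q\<close> has smaller degree than
      \<open>p\<close>; so the index shift caused by \<open>A\<close> stays within the bound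
      \<open>card F = Suc N\<close>.\<close>
    have "coeff q (Suc N) = 0"
      using dq p(1) N by (intro coeff_eq_0) (auto simp: ok_def)
    then have "A (act q) = (\<Sum>i\<le>N. s (coeff q i) ((A ^^ Suc i) v))"
      by (simp add: act_def N A.sum A.scale)
    also have "\<dots> = (\<Sum>i\<le>Suc N. s (coeff (pCons 0 q) i) ((A ^^ i) v))"
      by (subst sum.atMost_Suc_shift) simp
    finally have "A (act q) - s z (act q) =
        (\<Sum>i\<le>Suc N. s (coeff (pCons 0 q) i - z * coeff q i) ((A ^^ i) v))"
      by (simp only: act_def N scale_sum_right sum_subtractf[symmetric] scale_left_diff_distrib scale_scale)
    also have "\<dots> = act p"
      by (simp add: act_def N q)
    finally show ?thesis .
  qed
  ultimately show ?thesis
    using that[of "act q" z] p(1) by (simp add: ok_def)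
qed

text \<open>By induction on \<open>dim Q\<close>. If every operator is scalar on \<open>Q\<close>
  modulo \<open>P\<close>, any vector of \<open>Q\<close> outside \<open>P\<close> will do.
  Otherwise some \<open>A i\<close> has an eigenspace \<open>R\<close> modulo \<open>P\<close> that
  is properly smaller than \<open>Q\<close>, not contained in \<open>P\<close>, and invariant
  because the operators commute and preserve \<open>P\<close>.\<close>

lemma common_eigenvector_mod:
  assumes lin: "\<And>i. i \<in> I \<Longrightarrow> Vector_Spaces.linear s s (A i)"
    and comm: "\<And>i j v. i \<in> I \<Longrightarrow> j \<in> I \<Longrightarrow> A i (A j v) = A j (A i v)"
    and P: "subspace P" "\<And>i v. i \<in> I \<Longrightarrow> v \<in> P \<Longrightarrow> A i v \<in> P"
    and fin: "finite F"
    and Q: "subspace Q" "\<And>i v. i \<in> I \<Longrightarrow> v \<in> Q \<Longrightarrow> A i v \<in> Q" "Q \<subseteq> span F" "\<not> Q \<subseteq> P"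
  shows "\<exists>v \<mu>. v \<in> Q \<and> v \<notin> P \<and> (\<forall>i\<in>I. A i v - s (\<mu> i) v \<in> P)"
  using Q
proof (induction "dim Q" arbitrary: Q rule: less_induct)
  case less
  show ?case
  proof (cases "\<forall>i\<in>I. \<exists>z. \<forall>v\<in>Q. A i v - s z v \<in> P")
    case True
    then obtain \<mu> where "\<forall>i\<in>I. \<forall>v\<in>Q. A i v - s (\<mu> i) v \<in> P" by metis
    then show ?thesis using less.prems(4) by blast
  next
    case False
    then obtain i where i: "i \<in> I" "\<And>z. \<exists>v\<in>Q. A i v - s z v \<notin> P" by blast
    obtain v where v: "v \<in> Q" "v \<notin> P" using less.prems(4) by blast
    obtain w z where w: "w \<in> Q" "w \<notin> P" "A i w - s z w \<in> P"
      using eigenvector_mod[OF lin[OF i(1)] P(1) less.prems(1) less.prems(2)[OF i(1)] fin less.prems(3) v] by blast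
    interpret Ai: Vector_Spaces.linear s s "A i" using lin i(1) .
    define R where "R = {v \<in> Q. A i v - s z v \<in> P}"
    have "subspace R"
    proof (rule subspaceI)
      show "0 \<in> R" using less.prems(1) P(1) by (simp add: R_def Ai.zero subspace_0)
    next
      fix u v assume "u \<in> R" "v \<in> R"
      moreover have "A i (u + v) - s z (u + v) = (A i u - s z u) + (A i v - s z v)"
        by (simp add: Ai.add scale_right_distrib)
      ultimately show "u + v \<in> R"
        using less.prems(1) P(1) by (simp add: R_def subspace_add)
    next
      fix c v assume "v \<in> R"
      moreover have "A i (s c v) - s z (s c v) = s c (A i v - s z v)"
        by (simp add: Ai.scale scale_right_diff_distrib mult.commute)
      ultimately show "s c v \<in> R"
        using less.prems(1) P(1) by (simp add: R_def subspace_scale)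
    qed
    moreover have "A j v \<in> R" if "j \<in> I" "v \<in> R" for j v
    proof -
      interpret Aj: Vector_Spaces.linear s s "A j" using lin that(1) .
      have "A i (A j v) - s z (A j v) = A j (A i v - s z v)"
        using comm[OF i(1) that(1)] by (simp add: Aj.diff Aj.scale)
      then show ?thesis using that less.prems(2) P(2) by (simp add: R_def)
    qed
    moreover have "R \<subset> Q" using i(2)[of z] by (auto simp: R_def)
    moreover have "\<not> R \<subseteq> P" using w by (auto simp: R_def)
    ultimately have "\<exists>v \<mu>. v \<in> R \<and> v \<notin> P \<and> (\<forall>i\<in>I. A i v - s (\<mu> i) v \<in> P)"
      using less.prems(3) dim_less_subspace[OF _ _ less.prems(3) fin] by (intro less.hyps) auto
    then show ?thesis by (auto simp: R_def)
  qed
qed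

end


section \<open>Functionals on the orbit\<close>

lemma vector_space_dual_scale: "vector_space (dual_scale :: 'k::field \<Rightarrow> ('a \<Rightarrow> 'k) \<Rightarrow> 'a \<Rightarrow> 'k)"
  by standard (auto simp: dual_scale_def algebra_simps)

lemma linear_comp_dual_scale:
  "Vector_Spaces.linear dual_scale dual_scale (\<lambda>f :: 'a \<Rightarrow> 'k::field. \<lambda>v. f (T v))"
  unfolding Vector_Spaces.linear_iff by (auto simp: vector_space_dual_scale dual_scale_def)

interpretation dual: complex_vector_space "dual_scale :: complex \<Rightarrow> ('a \<Rightarrow> complex) \<Rightarrow> _"
  by (simp add: complex_vector_space_def vector_space_dual_scale)

lemma span_dual_pair:
  "f \<in> dual.span {g, k} \<longleftrightarrow> (\<exists>c d. \<forall>v. f v = c * g v + d * k v)"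
proof -
  have "f \<in> dual.span {g, k} \<longleftrightarrow> (\<exists>c d. f = dual_scale c g + dual_scale d k)"
    by (auto simp: dual.span_insert dual.span_singleton algebra_simps)
  then show ?thesis by (simp add: fun_eq_iff dual_scale_def)
qed

text \<open>\<open>g\<close> factors through the image of \<open>f\<close>, a real subspace of the
  plane, and real-linear maps from there to the complex numbers are combinations of the identity and
  conjugation. The cases are image of dimension one, zero and two.\<close>

lemma real_functional_kernel_le:
  fixes f g :: "'v::ab_group_add \<Rightarrow> complex"
  assumes add: "\<And>u v. f (u + v) = f u + f v" "\<And>u v. g (u + v) = g u + g v"
    and scal: "\<And>r v. f (s r v) = of_real r * f v" "\<And>r v. g (s r v) = of_real r * g v"
    and ker: "\<And>v. f v = 0 \<Longrightarrow> g v = 0"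
  shows "g \<in> dual.span {f, \<lambda>v. cnj (f v)}"
proof -
  have diff: "f (u - v) = f u - f v" "g (u - v) = g u - g v" for u v
    using add(1)[of "u - v" v] add(2)[of "u - v" v] by simp_all
  consider u where "f u \<noteq> 0" "\<And>v. Im (f v * cnj (f u)) = 0" | "\<forall>v. f v = 0"
    | u w where "Im (f u * cnj (f w)) \<noteq> 0" by blast
  then have "\<exists>a b. \<forall>v. g v = a * f v + b * cnj (f v)"
  proof cases
    case 1
    define c where "c = g u / f u"
    have "g v = c * f v" for v
    proof -
      define r where "r = Re (f v / f u)"
      have "Im (f v / f u) = 0" 
        using 1(2)[of v] unfolding complex_div_cnj[of "f v" "f u"] of_real_power[symmetric] Im_divide_of_real
        by (simp only: div_0)
      then have "f v / f u = of_real r" by (simp add: r_def complex_eq_iff)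
      then have r: "f v = of_real r * f u" using 1(1) by (simp add: field_simps)
      then have "f (v - s r u) = 0" by (simp add: diff scal)
      then have "g (v - s r u) = 0" by (rule ker)
      then have "g v = of_real r * g u" by (simp add: diff scal)
      then show ?thesis using r 1(1) by (simp add: c_def)
    qed
    then show ?thesis by (intro exI[of _ c] exI[of _ 0]) simp
  next
    case 2
    then show ?thesis using ker by (intro exI[of _ 0]) simp
  next
    case 3
    \<comment> \<open>Cramer's rule for the coefficients \<open>a\<close>, \<open>b\<close> matching
      \<open>g\<close> at \<open>u\<close> and \<open>w\<close>.\<close>
    define D where "D = f u * cnj (f w) - cnj (f u) * f w"
    have "Im D = 2 * Im (f u * cnj (f w))" by (simp add: D_def)
    then have "D \<noteq> 0" using 3 by auto
    define a where "a = (g u * cnj (f w) - g w * cnj (f u)) / D"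
    define b where "b = (f u * g w - f w * g u) / D"
    have "(a * f u + b * cnj (f u)) * D = g u * D" "(a * f w + b * cnj (f w)) * D = g w * D"
      using \<open>D \<noteq> 0\<close> by (simp_all add: a_def b_def distrib_right) (simp_all add: D_def algebra_simps)
    then have ab: "a * f u + b * cnj (f u) = g u" "a * f w + b * cnj (f w) = g w"
      using \<open>D \<noteq> 0\<close> by simp_all
    have "g v = a * f v + b * cnj (f v)" for v
    proof -
      \<comment> \<open>\<open>A / E\<close> and \<open>B / E\<close> are the real coordinates of
        \<open>f v\<close> in the basis \<open>f u\<close>, \<open>f w\<close>.\<close>
      define A B E where "A = Im (f v * cnj (f w))" and "B = Im (f u * cnj (f v))"
        and "E = Im (f u * cnj (f w))"
      define r t where "r = A / E" and "t = B / E"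
      have "f v * of_real E = of_real A * f u + of_real B * f w"
        by (simp add: A_def B_def E_def complex_eq_iff algebra_simps)
      moreover have "E \<noteq> 0" using 3 by (simp add: E_def)
      ultimately have v: "f v = of_real r * f u + of_real t * f w"
        by (simp add: r_def t_def field_simps)
      then have "f (v - s r u - s t w) = 0" by (simp only: diff scal) simp
      then have "g (v - s r u - s t w) = 0" by (rule ker)
      then have "g v = of_real r * g u + of_real t * g w"
        by (simp only: diff scal) (simp add: algebra_simps)
      then show ?thesis by (simp add: v ab[symmetric] algebra_simps)
    qed
    then show ?thesis by blast
  qed
  then show ?thesis by (simp add: span_dual_pair)
qed

lemma complex_functional_kernel_le:
  fixes f g :: "'v::ab_group_add \<Rightarrow> complex"
  assumes add: "\<And>u v. f (u + v) = f u + f v" "\<And>u v. g (u + v) = g u + g v"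
    and scal: "\<And>r v. f (s r v) = r * f v" "\<And>r v. g (s r v) = r * g v"
    and ker: "\<And>v. f v = 0 \<Longrightarrow> g v = 0"
  shows "\<exists>c. \<forall>v. g v = c * f v"
proof (cases "\<forall>v. f v = 0")
  case False
  then obtain w where w: "f w \<noteq> 0" by blast
  have "g v = g w / f w * f v" for v
  proof -
    have "f (v + s (- f v / f w) w) = 0" using w by (simp add: add scal)
    then have "g (v + s (- f v / f w) w) = 0" by (rule ker)
    then show ?thesis by (simp add: add scal field_simps)
  qed
  then show ?thesis by blast
qed (use ker in auto)

context supercyclic_semigroup
begin

lemma common_eigenfunctional_mod:
  fixes P W :: "('a \<Rightarrow> complex) set"
  assumes P: "dual.subspace P" "\<forall>f\<in>P. \<forall>t\<ge>0. (\<lambda>v. f (T t v)) \<in> P"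
    and W: "dual.subspace W" "\<forall>f\<in>W. \<forall>t\<ge>0. (\<lambda>v. f (T t v)) \<in> W"
    and fin: "finite F" "W \<subseteq> dual.span F" and ne: "\<not> W \<subseteq> P"
  obtains f \<mu> where "f \<in> W" "f \<notin> P" "\<forall>t\<ge>0. (\<lambda>v. f (T t v)) - dual_scale (\<mu> t) f \<in> P"
proof -
  have "\<exists>f \<mu>. f \<in> W \<and> f \<notin> P \<and> (\<forall>t\<in>{0..}. (\<lambda>v. f (T t v)) - dual_scale (\<mu> t) f \<in> P)"
    by (rule dual.common_eigenvector_mod[OF _ _ P(1) _ fin(1) W(1) _ fin(2) ne])
      (use P(2) W(2) in \<open>auto simp: linear_comp_dual_scale T_T add.commute\<close>)
  then show ?thesis using that by auto
qed

text \<open>The operator \<open>f \<mapsto> f \<circ> T t1 - l t1 f\<close> kills \<open>f1\<close>, so that it removes the component along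
  \<open>f1\<close> from the action on \<open>g\<close>.\<close>

lemma remove_component:
  fixes W :: "('a \<Rightarrow> complex) set"
  assumes W: "dual.subspace W" "\<forall>f\<in>W. \<forall>t\<ge>0. (\<lambda>v. f (T t v)) \<in> W"
    and g: "g \<in> W" "g \<notin> dual.span {f1, f2}"
    and eig: "\<forall>t\<ge>0. \<forall>v. f1 (T t v) = l t * f1 v" "\<forall>t\<ge>0. \<forall>v. f2 (T t v) = n t * f2 v"
      "\<forall>t\<ge>0. \<forall>v. g (T t v) = m t * g v + a t * f1 v + b t * f2 v"
    and t1: "t1 \<ge> 0" "m t1 \<noteq> l t1"
  obtains g' where "g' \<in> W" "g' \<notin> dual.span {f1, f2}"
    "\<forall>t\<ge>0. \<forall>v. g' (T t v) = m t * g' v + b t * (n t1 - l t1) * f2 v"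
proof
  define g' where "g' = (\<lambda>v. g (T t1 v)) - dual_scale (l t1) g"
  have g': "g' v = g (T t1 v) - l t1 * g v" for v by (simp add: g'_def dual_scale_def)
  show "g' \<in> W"
    unfolding g'_def using W g t1 by (intro dual.subspace_diff dual.subspace_scale) auto
  show "\<forall>t\<ge>0. \<forall>v. g' (T t v) = m t * g' v + b t * (n t1 - l t1) * f2 v"
  proof (intro allI impI)
    fix t v assume "t \<ge> (0::real)"
    then have "T t1 (T t v) = T t (T t1 v)" using t1 by (simp add: T_T add.commute)
    then show "g' (T t v) = m t * g' v + b t * (n t1 - l t1) * f2 v"
      using eig t1 \<open>t \<ge> 0\<close> by (simp add: g' algebra_simps)
  qed
  show "g' \<notin> dual.span {f1, f2}"
  proof
    assume "g' \<in> dual.span {f1, f2}"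
    then obtain c d where "\<And>v. g' v = c * f1 v + d * f2 v" by (auto simp: span_dual_pair)
    then have eq: "(m t1 - l t1) * g v = (c - a t1) * f1 v + (d - b t1) * f2 v" for v
      using eig t1 g'[of v] by (simp add: algebra_simps)
    have "g v = (c - a t1) / (m t1 - l t1) * f1 v + (d - b t1) / (m t1 - l t1) * f2 v" for v
    proof -
      have "g v = ((m t1 - l t1) * g v) / (m t1 - l t1)" using t1(2) by simp
      then show ?thesis unfolding eq by (simp add: add_divide_distrib)
    qed
    then show False using g(2) unfolding span_dual_pair by blast
  qed
qed

end


section \<open>Bounds on finite-dimensional invariant spaces of functionals\<close>

lemma sum_fun_apply: "(\<Sum>i\<in>A. f i) v = (\<Sum>i\<in>A. f i v)"
  for f :: "'i \<Rightarrow> 'a \<Rightarrow> 'b::comm_monoid_add"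
  by (induction A rule: infinite_finite_induct) auto

lemma span_comp:
  fixes f :: "'a \<Rightarrow> 'k::field"
  assumes "\<And>g. g \<in> F \<Longrightarrow> (\<lambda>v. g (T v)) \<in> module.span dual_scale F" "f \<in> module.span dual_scale F"
  shows "(\<lambda>v. f (T v)) \<in> module.span dual_scale F"
proof -
  interpret D: vector_space "dual_scale :: 'k \<Rightarrow> ('a \<Rightarrow> 'k) \<Rightarrow> _" by (rule vector_space_dual_scale)
  interpret A: Vector_Spaces.linear "dual_scale :: 'k \<Rightarrow> ('a \<Rightarrow> 'k) \<Rightarrow> _" dual_scale "\<lambda>f v. f (T v)"
    by (rule linear_comp_dual_scale)
  have "(\<lambda>v. f (T v)) \<in> D.span ((\<lambda>f v. f (T v)) ` F)"
    using assms(2) by (simp add: A.span_image)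
  also have "\<dots> \<subseteq> D.span F"
    using assms(1) by (intro D.span_minimal D.subspace_span) auto
  finally show ?thesis .
qed

definition homogeneous_functional ::
  "('k \<Rightarrow> complex) \<Rightarrow> ('k \<Rightarrow> 'v \<Rightarrow> 'v) \<Rightarrow> ('v::{plus,topological_space} \<Rightarrow> complex) \<Rightarrow> bool" where
  "homogeneous_functional h s f \<longleftrightarrow> continuous_on UNIV f \<and> (\<forall>u v. f (u + v) = f u + f v) \<and>
     (\<forall>z v. f (s z v) = h z * f v)"

lemma homogeneous_functional_span:
  assumes "\<And>g. g \<in> F \<Longrightarrow> homogeneous_functional h s g" "f \<in> dual.span F"
  shows "homogeneous_functional h s f"
  using assms(2)
proof (induction rule: dual.span_induct_alt)
  case base
  then show ?case by (simp add: homogeneous_functional_def zero_fun_def)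
next
  case (step c g f)
  with assms(1)[of g] show ?case
    by (auto simp: homogeneous_functional_def dual_scale_def plus_fun_def algebra_simps
        intro!: continuous_intros)
qed

lemma not_subset_span_pair:
  assumes "B \<subseteq> dual.span F" "\<not> dual.dependent B" "card B > card {f, g}"
  shows "\<not> dual.span F \<subseteq> dual.span {f, g}"
proof
  assume "dual.span F \<subseteq> dual.span {f, g}"
  then have "card B \<le> card {f, g}"
    using dual.independent_span_bound[OF _ assms(2), of "{f, g}"] assms(1) by auto
  with assms(3) show False by simp
qed

lemma dual_eigen_mod_zero:
  assumes "\<forall>t\<ge>(0::real). (\<lambda>v. f (T t v)) - dual_scale (m t) f \<in> {0}"
  shows "\<forall>t\<ge>0. \<forall>v. f (T t v) = m t * f v"
proof (intro allI impI)
  fix t v assume "t \<ge> (0::real)"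
  then have "(\<lambda>v. f (T t v)) = (\<lambda>v. m t * f v)" using assms by (simp add: dual_scale_def)
  then show "f (T t v) = m t * f v" by (rule fun_cong)
qed

lemma dual_eigen_mod_pair:
  assumes "\<forall>t\<ge>(0::real). (\<lambda>v. f (T t v)) - dual_scale (m t) f \<in> dual.span {g, k}"
  obtains a b where "\<forall>t\<ge>0. \<forall>v. f (T t v) = m t * f v + a t * g v + b t * k v"
proof -
  have "\<forall>t. \<exists>c d. t \<ge> 0 \<longrightarrow> (\<forall>v. f (T t v) - m t * f v = c * g v + d * k v)"
    using assms by (simp add: span_dual_pair dual_scale_def)
  then obtain a b where "\<forall>t\<ge>0. \<forall>v. f (T t v) - m t * f v = a t * g v + b t * k v"
    by metis
  then show ?thesis by (intro that[of a b]) (simp add: algebra_simps)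
qed

lemma span_pair_invariant:
  assumes "\<And>v. g (T v) = l * g v" "\<And>v. k (T v) = n * k v" "f \<in> dual.span {g, k}"
  shows "(\<lambda>v. f (T v)) \<in> dual.span {g, k}"
proof -
  obtain c d where "\<And>v. f v = c * g v + d * k v" using assms(3) by (auto simp: span_dual_pair)
  then have "\<forall>v. f (T v) = (c * l) * g v + (d * n) * k v" using assms(1,2) by simp
  then show ?thesis unfolding span_dual_pair by blast
qed

text \<open>Given two independent functionals, there are an eigenfunctional \<open>f\<close> and a
  \<open>g\<close> that is one modulo \<open>f\<close>. If \<open>m = l\<close>,
  \<open>jordan_pair_nested\<close> puts the kernel of \<open>f\<close> into that of
  \<open>g\<close>. If not, \<open>remove_component\<close> yields an eigenfunctional, and
  \<open>eigen_pair_nested\<close> compares the kernels. In both cases the functionals would be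
  proportional.\<close>

lemma complex_invariant_functionals:
  fixes s :: "complex \<Rightarrow> 'a::{topological_ab_group_add,t2_space} \<Rightarrow> 'a"
  assumes "supercyclic_semigroup s T x"
    and F: "finite F" "F \<subseteq> continuous_dual s"
    and inv: "\<And>t g. t \<ge> 0 \<Longrightarrow> g \<in> F \<Longrightarrow> (\<lambda>v. g (T t v)) \<in> dual.span F"
    and B: "B \<subseteq> dual.span F" "\<not> dual.dependent B"
  shows "card B < 2"
proof (rule ccontr)
  assume card: "\<not> card B < 2"
  interpret supercyclic_semigroup s T x by fact
  let ?W = "dual.span F"
  let ?hom = "homogeneous_functional (\<lambda>z. z) s"
  have "?hom g" if "g \<in> F" for g
    using that F(2)
    by (auto simp: continuous_dual_def homogeneous_functional_def Vector_Spaces.linear_iff)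
  then have hom: "?hom f" if "f \<in> ?W" for f
    using homogeneous_functional_span that by blast
  then have cont: "continuous_on UNIV f" and add: "f (u + v) = f u + f v"
    and scal: "f (s z v) = z * f v" if "f \<in> ?W" for f u v z
    using that by (auto simp: homogeneous_functional_def)
  have WT: "\<forall>f\<in>?W. \<forall>t\<ge>0. (\<lambda>v. f (T t v)) \<in> ?W"
    using inv by (blast intro: span_comp)
  have zero: "dual.subspace {0 :: 'a \<Rightarrow> complex}" by (simp add: dual.subspace_def)
  have zT: "\<forall>f\<in>{0 :: 'a \<Rightarrow> complex}. \<forall>t\<ge>0. (\<lambda>v. f (T t v)) \<in> {0}" by (simp add: zero_fun_def)
  have nz: "\<not> ?W \<subseteq> {0}"
    using not_subset_span_pair[OF B, of 0 0] card dual.span_zero[of "{0, 0}"] by auto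
  obtain f l where f: "f \<in> ?W" "f \<notin> {0}"
    "\<forall>t\<ge>0. (\<lambda>v. f (T t v)) - dual_scale (l t) f \<in> {0}"
    by (rule common_eigenfunctional_mod[OF zero zT dual.subspace_span WT F(1) subset_refl nz])
  have fT: "\<forall>t\<ge>0. \<forall>v. f (T t v) = l t * f v"
    by (rule dual_eigen_mod_zero[OF f(3)])
  obtain w where w: "f w \<noteq> 0" using f(2) by (auto simp: fun_eq_iff)
  \<comment> \<open>The line through \<open>f\<close> is written with a second generator 0 so that
    the lemmas on pairs apply. For the count the pair is \<open>{f, f}\<close>, of cardinality
    1.\<close>
  have nP: "\<not> ?W \<subseteq> dual.span {f, 0}"
    using not_subset_span_pair[OF B, of f f] card by (auto simp: dual.span_insert_0 insert_commute)
  have "(\<lambda>v. g (T t v)) \<in> dual.span {f, 0}" if "g \<in> dual.span {f, 0}" "t \<ge> 0" for g t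
    by (rule span_pair_invariant[of f _ "l t" 0 0]) (use that fT in auto)
  then have PT: "\<forall>g\<in>dual.span {f, 0}. \<forall>t\<ge>0. (\<lambda>v. g (T t v)) \<in> dual.span {f, 0}" by blast
  obtain g m where g: "g \<in> ?W" "g \<notin> dual.span {f, 0}"
    "\<forall>t\<ge>0. (\<lambda>v. g (T t v)) - dual_scale (m t) g \<in> dual.span {f, 0}"
    by (rule common_eigenfunctional_mod[OF dual.subspace_span PT dual.subspace_span WT F(1) subset_refl nP])
  obtain a b where gT: "\<forall>t\<ge>0. \<forall>v. g (T t v) = m t * g v + a t * f v + b t * (0 :: 'a \<Rightarrow> complex) v"
    by (rule dual_eigen_mod_pair[OF g(3)])
  have ker: "\<exists>v. f v = 0 \<and> g' v \<noteq> 0" if "g' \<in> ?W" "g' \<notin> dual.span {f, 0}" for g'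
  proof (rule ccontr)
    assume "\<not> ?thesis"
    then have "\<exists>c. \<forall>v. g' v = c * f v"
      using add scal f(1) that(1) by (intro complex_functional_kernel_le[of f g' s]) auto
    with that(2) show False by (auto simp: span_dual_pair)
  qed
  show False
  proof (cases "\<forall>t\<ge>0. m t = l t")
    case True
    obtain v where v: "f v = 0" "g v \<noteq> 0" using ker[OF g(1,2)] by blast
    have "g v = 0"
      by (rule jordan_pair_nested[OF cont[OF f(1)] cont[OF g(1)] add[OF f(1)] add[OF g(1)]
            scal[OF f(1)] scal[OF g(1)] _ fT _ w v(1), of a]) (use gT True in auto)
    with v show False by simp
  next
    case False
    then obtain t1 where t1: "t1 \<ge> 0" "m t1 \<noteq> l t1" by blast
    have zeroT: "\<forall>t\<ge>0. \<forall>v. (0 :: 'a \<Rightarrow> complex) (T t v) = 0 * (0 :: 'a \<Rightarrow> complex) v" by simp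
    obtain g' where g': "g' \<in> ?W" "g' \<notin> dual.span {f, 0}"
      "\<forall>t\<ge>0. \<forall>v. g' (T t v) = m t * g' v + b t * (0 - l t1) * (0 :: 'a \<Rightarrow> complex) v"
      by (rule remove_component[OF dual.subspace_span WT g(1,2) fT zeroT gT t1])
    have g'T: "\<forall>t\<ge>0. \<forall>v. g' (T t v) = m t * g' v" using g'(3) by simp
    obtain v where v: "f v = 0" "g' v \<noteq> 0" using ker[OF g'(1,2)] by blast
    then have "f u = 0" if "g' u = 0" for u
      using that eigen_pair_nested[OF cont[OF f(1)] cont[OF g'(1)] scal[OF f(1)] scal[OF g'(1)] fT g'T]
      by blast
    then have "\<exists>c. \<forall>v. f v = c * g' v"
      using add scal f(1) g'(1) by (intro complex_functional_kernel_le[of g' f s]) auto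
    then obtain c where c: "\<And>v. f v = c * g' v" by blast
    then have "c \<noteq> 0" using w by auto
    then show False using v c by auto
  qed
qed

text \<open>Complexification provides common eigenfunctionals and a space \<open>?W\<close> closed
  under \<open>bar\<close>. A functional that vanishes on the kernel of \<open>f\<close> is only
  known to lie in \<open>?P\<close>, of dimension at most two, so a third independent functional is
  what guarantees some \<open>g\<close> outside. On \<open>?P\<close> the multipliers are
  \<open>l\<close> and its conjugate, and the cases compare \<open>m\<close> with both.\<close>

lemma real_invariant_functionals:
  fixes s :: "real \<Rightarrow> 'a::{topological_ab_group_add,t2_space} \<Rightarrow> 'a"
  assumes "supercyclic_semigroup s T x"
    and F: "finite F" "F \<subseteq> continuous_dual s"
    and inv: "\<And>t g. t \<ge> 0 \<Longrightarrow> g \<in> F \<Longrightarrow> (\<lambda>v. g (T t v)) \<in> module.span dual_scale F"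
    and B: "B \<subseteq> module.span dual_scale F" "\<not> module.dependent dual_scale B"
  shows "card B < 3"
proof (rule ccontr)
  assume card: "\<not> card B < 3"
  interpret supercyclic_semigroup s T x by fact
  interpret R: vector_space "dual_scale :: real \<Rightarrow> ('a \<Rightarrow> real) \<Rightarrow> _"
    by (rule vector_space_dual_scale)
  define cx where "cx g = (\<lambda>v :: 'a. complex_of_real (g v))" for g
  let ?W = "dual.span (cx ` F)"
  have cx_span: "cx g \<in> ?W" if "g \<in> R.span F" for g
    using that
  proof (induction rule: R.span_induct_alt)
    case base
    have "cx 0 = 0" by (auto simp: cx_def)
    then show ?case by (simp only: dual.span_zero)
  next
    case (step c g h)
    have eq: "cx (dual_scale c g + h) = dual_scale (of_real c) (cx g) + cx h"
      by (auto simp: cx_def dual_scale_def)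
    show ?case
      unfolding eq using step by (intro dual.span_add[OF dual.span_scale[OF dual.span_base]]) auto
  qed
  let ?hom = "homogeneous_functional of_real s"
  have "?hom (cx g)" if "g \<in> F" for g
    using that F(2)
    by (auto simp: continuous_dual_def homogeneous_functional_def Vector_Spaces.linear_iff cx_def
        intro!: continuous_intros)
  then have hom: "?hom f" if "f \<in> ?W" for f
    using homogeneous_functional_span that by blast
  then have cont: "continuous_on UNIV f" and add: "f (u + v) = f u + f v"
    and scal: "f (s z v) = of_real z * f v" if "f \<in> ?W" for f u v z
    using that by (auto simp: homogeneous_functional_def)
  have "(\<lambda>v. (cx g) (T t v)) \<in> ?W" if "g \<in> F" "t \<ge> 0" for g t
    using cx_span[OF inv[OF that(2,1)]] by (simp add: cx_def)
  then have WT: "\<forall>f\<in>?W. \<forall>t\<ge>0. (\<lambda>v. f (T t v)) \<in> ?W"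
    by (blast intro: span_comp)
  define bar where "bar f = (\<lambda>v :: 'a. cnj (f v))" for f
  have bar_bar: "bar (bar f) = f" for f by (simp add: bar_def)
  have W_bar: "bar f \<in> ?W" if "f \<in> ?W" for f
    using that
  proof (induction rule: dual.span_induct_alt)
    case base
    have "bar 0 = 0" by (auto simp: bar_def)
    then show ?case by (simp only: dual.span_zero)
  next
    case (step c g h)
    then have "bar g = g" by (auto simp: bar_def cx_def)
    then have eq: "bar (dual_scale c g + h) = dual_scale (cnj c) g + bar h"
      by (auto simp: bar_def dual_scale_def fun_eq_iff)
    show ?case
      unfolding eq using step by (intro dual.span_add[OF dual.span_scale[OF dual.span_base]]) auto
  qed
  have inj: "inj cx" by (auto intro!: injI simp: cx_def fun_eq_iff)
  have "finite B" using card card.infinite by fastforce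
  have indB: "\<not> dual.dependent (cx ` B)"
    unfolding dual.independent_explicit_finite_subsets
  proof (intro allI impI ballI)
    fix A u h assume A: "A \<subseteq> cx ` B" "finite A" "(\<Sum>h\<in>A. dual_scale (u h) h) = 0" "h \<in> A"
    obtain A' where A': "A' \<subseteq> B" "A = cx ` A'" using A(1) by (auto simp: subset_image_iff)
    then have "finite A'" using A(2) inj finite_imageD inj_on_subset by blast
    have "(\<Sum>h\<in>A. dual_scale (u h) h) = (\<Sum>g\<in>A'. dual_scale (u (cx g)) (cx g))"
      unfolding A'(2) by (subst sum.reindex[OF inj_on_subset[OF inj]]) auto
    then have sum: "(\<Sum>g\<in>A'. u (cx g) * of_real (g v)) = 0" for v
      using fun_cong[OF A(3), of v] by (simp add: sum_fun_apply dual_scale_def cx_def)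
    have "(\<Sum>g\<in>A'. Re (u (cx g)) * g v) = 0" "(\<Sum>g\<in>A'. Im (u (cx g)) * g v) = 0" for v
      using arg_cong[OF sum[of v], of Re] arg_cong[OF sum[of v], of Im] by simp_all
    then have "(\<Sum>g\<in>A'. dual_scale (Re (u (cx g))) g) = 0" "(\<Sum>g\<in>A'. dual_scale (Im (u (cx g))) g) = 0"
      by (auto simp: fun_eq_iff dual_scale_def sum_fun_apply)
    from R.independentD[OF B(2) \<open>finite A'\<close> A'(1) this(1)] R.independentD[OF B(2) \<open>finite A'\<close> A'(1) this(2)]
    have "u (cx g) = 0" if "g \<in> A'" for g
      using that by (simp add: complex_eq_iff)
    then show "u h = 0" using A(4) A'(2) by auto
  qed
  have cardB: "card (cx ` B) = card B" using inj by (simp add: card_image inj_on_subset)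
  have BW: "cx ` B \<subseteq> ?W" using cx_span B(1) by auto
  have notin: "\<not> ?W \<subseteq> dual.span {f, g}" for f g
  proof (rule not_subset_span_pair[OF BW indB])
    have "card {f, g} \<le> 2" by (simp add: card_insert_if)
    then show "card {f, g} < card (cx ` B)" using card cardB by simp
  qed
  have finW: "finite (cx ` F)" using F by simp
  have zero: "dual.subspace {0 :: 'a \<Rightarrow> complex}" by (simp add: dual.subspace_def)
  have zT: "\<forall>f\<in>{0 :: 'a \<Rightarrow> complex}. \<forall>t\<ge>0. (\<lambda>v. f (T t v)) \<in> {0}" by (simp add: zero_fun_def)
  have nz: "\<not> ?W \<subseteq> {0}"
    using notin[of 0 0] dual.span_zero[of "{0, 0}"] by auto
  obtain f0 l where f0: "f0 \<in> ?W" "f0 \<notin> {0}"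
    "\<forall>t\<ge>0. (\<lambda>v. f0 (T t v)) - dual_scale (l t) f0 \<in> {0}"
    by (rule common_eigenfunctional_mod[OF zero zT dual.subspace_span WT finW subset_refl nz])
  have f0T: "\<forall>t\<ge>0. \<forall>v. f0 (T t v) = l t * f0 v"
    by (rule dual_eigen_mod_zero[OF f0(3)])
  \<comment> \<open>If all \<open>l t\<close> are real, a real-valued eigenfunctional exists:
    \<open>f0 + bar f0\<close>, or \<open>dual_scale \<i> f0\<close> when that sum is zero. If not,
    some \<open>l t\<close> differs from its conjugate.\<close>
  obtain f where f: "f \<in> ?W" "f \<noteq> 0" "\<forall>t\<ge>0. \<forall>v. f (T t v) = l t * f v"
    and f_bar: "bar f = f \<or> (\<exists>t\<ge>0. cnj (l t) \<noteq> l t)"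
  proof (cases "\<exists>t\<ge>0. cnj (l t) \<noteq> l t")
    case True
    then show ?thesis using that[of f0] f0 f0T by auto
  next
    case False
    then have real: "cnj (l t) = l t" if "t \<ge> 0" for t using that by blast
    show ?thesis
    proof (cases "f0 + bar f0 = 0")
      case True
      then have "bar f0 v = - f0 v" for v
        using True by (simp add: fun_eq_iff eq_neg_iff_add_eq_0 add.commute)
      then have "bar (dual_scale \<i> f0) = dual_scale \<i> f0"
        by (auto simp: bar_def dual_scale_def)
      moreover have "dual_scale \<i> f0 \<noteq> 0" using f0(2) by (auto simp: dual_scale_def fun_eq_iff)
      ultimately show ?thesis
        using f0 f0T by (intro that[of "dual_scale \<i> f0"] dual.span_scale) (auto simp: dual_scale_def)
    next
      case False
      have "bar (f0 + bar f0) = f0 + bar f0" by (auto simp: bar_def)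
      then show ?thesis
        using f0 f0T real False W_bar
        by (intro that[of "f0 + bar f0"] dual.span_add) (auto simp: bar_def algebra_simps)
    qed
  qed
  have fbT: "\<forall>t\<ge>0. \<forall>v. bar f (T t v) = cnj (l t) * bar f v"
    using f(3) by (simp add: bar_def)
  obtain w where w: "f w \<noteq> 0" using f(2) by (auto simp: fun_eq_iff)
  have wb: "bar f w \<noteq> 0" using w by (simp add: bar_def)
  let ?P = "dual.span {f, bar f}"
  have "(\<lambda>v. g (T t v)) \<in> ?P" if "g \<in> ?P" "t \<ge> 0" for g t
    by (rule span_pair_invariant[of f _ "l t" "bar f" "cnj (l t)"]) (use that f(3) fbT in auto)
  then have PT: "\<forall>g\<in>?P. \<forall>t\<ge>0. (\<lambda>v. g (T t v)) \<in> ?P" by blast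
  obtain g m where g: "g \<in> ?W" "g \<notin> ?P"
    "\<forall>t\<ge>0. (\<lambda>v. g (T t v)) - dual_scale (m t) g \<in> ?P"
    by (rule common_eigenfunctional_mod[OF dual.subspace_span PT dual.subspace_span WT finW subset_refl notin])
  obtain a b where gT: "\<forall>t\<ge>0. \<forall>v. g (T t v) = m t * g v + a t * f v + b t * bar f v"
    by (rule dual_eigen_mod_pair[OF g(3)])
  have ker: "\<exists>v. f v = 0 \<and> g' v \<noteq> 0" if "g' \<in> ?W" "g' \<notin> ?P" for g'
  proof (rule ccontr)
    assume "\<not> ?thesis"
    then have "g' \<in> dual.span {f, \<lambda>v. cnj (f v)}"
      using add scal f(1) that(1) by (intro real_functional_kernel_le[of f g' s]) auto
    with that(2) show False by (simp add: bar_def)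
  qed
  have jordan: False if g': "g' \<in> ?W" "g' \<notin> ?P" "\<forall>t\<ge>0. \<forall>v. g' (T t v) = l t * g' v + a' t * f v" for g' a'
  proof -
    obtain v where v: "f v = 0" "g' v \<noteq> 0" using ker[OF g'(1,2)] by blast
    have "g' v = 0"
      by (rule jordan_pair_nested[OF cont[OF f(1)] cont[OF g'(1)] add[OF f(1)] add[OF g'(1)]
            scal[OF f(1)] scal[OF g'(1)] _ f(3) g'(3) w v(1)]) simp
    with v show False by simp
  qed
  have jordan_bar: False
    if g': "g' \<in> ?W" "g' \<notin> ?P" "\<forall>t\<ge>0. \<forall>v. g' (T t v) = cnj (l t) * g' v + b' t * bar f v" for g' b'
  proof -
    obtain v where v: "f v = 0" "g' v \<noteq> 0" using ker[OF g'(1,2)] by blast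
    then have "bar f v = 0" by (simp add: bar_def)
    have "g' v = 0"
      by (rule jordan_pair_nested[OF cont[OF W_bar[OF f(1)]] cont[OF g'(1)] add[OF W_bar[OF f(1)]] add[OF g'(1)]
            scal[OF W_bar[OF f(1)]] scal[OF g'(1)] _ fbT g'(3) wb \<open>bar f v = 0\<close>]) simp
    with v show False by simp
  qed
  have comm: "{bar f, f} = {f, bar f}" by auto
  show False
  proof (cases "\<forall>t\<ge>0. m t = l t")
    case True
    show False
    proof (cases "bar f = f")
      case True
      then have "\<forall>t\<ge>0. \<forall>v. g (T t v) = l t * g v + (a t + b t) * f v"
        using gT \<open>\<forall>t\<ge>0. m t = l t\<close> by (simp add: algebra_simps)
      then show False by (rule jordan[OF g(1,2)])
    next
      case False
      \<comment> \<open>Now \<open>l\<close> is not real, so \<open>m = l\<close> differs from the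
        conjugate somewhere and the \<open>bar f\<close> component can be removed, leaving a Jordan
        pair with \<open>f\<close>.\<close>
      then obtain t1 where t1: "t1 \<ge> 0" "m t1 \<noteq> cnj (l t1)"
        using f_bar \<open>\<forall>t\<ge>0. m t = l t\<close> by metis
      have gT': "\<forall>t\<ge>0. \<forall>v. g (T t v) = m t * g v + b t * bar f v + a t * f v"
        using gT by (simp add: algebra_simps)
      obtain g' where g': "g' \<in> ?W" "g' \<notin> dual.span {bar f, f}"
        "\<forall>t\<ge>0. \<forall>v. g' (T t v) = m t * g' v + a t * (l t1 - cnj (l t1)) * f v"
        by (rule remove_component[OF dual.subspace_span WT g(1) g(2)[folded comm] fbT f(3) gT' t1])
      then show False using jordan[OF g'(1), of "\<lambda>t. a t * (l t1 - cnj (l t1))"] True by (simp add: comm)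
    qed
  next
    case False
    then obtain t1 where t1: "t1 \<ge> 0" "m t1 \<noteq> l t1" by blast
    \<comment> \<open>Removing the \<open>f\<close> component leaves a Jordan pair with
      \<open>bar f\<close> if \<open>m\<close> is the conjugate of \<open>l\<close>; otherwise a
      second removal gives an eigenfunctional \<open>k\<close>.\<close>
    define b' where "b' t = b t * (cnj (l t1) - l t1)" for t
    obtain g1 where g1: "g1 \<in> ?W" "g1 \<notin> ?P" "\<forall>t\<ge>0. \<forall>v. g1 (T t v) = m t * g1 v + b' t * bar f v"
      unfolding b'_def by (rule remove_component[OF dual.subspace_span WT g(1,2) f(3) fbT gT t1])
    show False
    proof (cases "\<forall>t\<ge>0. m t = cnj (l t)")
      case True
      then show False using jordan_bar[OF g1(1,2), of b'] g1(3) by simp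
    next
      case False
      then obtain t2 where t2: "t2 \<ge> 0" "m t2 \<noteq> cnj (l t2)" by blast
      have g1T: "\<forall>t\<ge>0. \<forall>v. g1 (T t v) = m t * g1 v + b' t * bar f v + 0 * f v"
        using g1(3) by simp
      obtain k where k: "k \<in> ?W" "k \<notin> dual.span {bar f, f}"
        "\<forall>t\<ge>0. \<forall>v. k (T t v) = m t * k v + 0 * (l t2 - cnj (l t2)) * f v"
        by (rule remove_component[OF dual.subspace_span WT g1(1) g1(2)[folded comm] fbT f(3) g1T t2])
      have kP: "k \<notin> ?P" using k(2) by (simp add: comm)
      have kT: "\<forall>t\<ge>0. \<forall>v. k (T t v) = m t * k v" using k(3) by simp
      have multiple: False if "\<And>v. f v = c * k v" for c
      proof -
        have "c \<noteq> 0" using w that by auto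
        then have "\<forall>v. k v = inverse c * f v + 0 * bar f v" using that by simp
        then show False using kP unfolding span_dual_pair by blast
      qed
      have multiple_cnj: False if "\<And>v. f v = c * cnj (k v)" for c
      proof -
        have "c \<noteq> 0" using w that by auto
        then have "\<forall>v. k v = 0 * f v + inverse (cnj c) * bar f v" using that by (simp add: bar_def)
        then show False using kP unfolding span_dual_pair by blast
      qed
      obtain v where "f v = 0" "k v \<noteq> 0" using ker[OF k(1) kP] by blast
      then have "f u = 0" if "k u = 0" for u
        using that eigen_pair_nested[OF cont[OF f(1)] cont[OF k(1)] scal[OF f(1)] scal[OF k(1)] f(3) kT]
        by blast
      then have "f \<in> dual.span {k, \<lambda>v. cnj (k v)}"
        using add scal f(1) k(1) by (intro real_functional_kernel_le[of k f s]) auto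
      then obtain c d where cd: "\<And>v. f v = c * k v + d * cnj (k v)"
        by (auto simp: span_dual_pair)
      \<comment> \<open>Evaluating \<open>f = c * k + d * cnj k\<close> at \<open>T t1 v\<close> in
        two ways relates \<open>k\<close> to its conjugate. As \<open>l t1 \<noteq> m t1\<close>,
        either \<open>c = 0\<close> or \<open>k\<close> is a multiple of \<open>cnj k\<close>; in
        both cases \<open>f\<close> is a multiple of \<open>cnj k\<close>, which puts
        \<open>k\<close> into \<open>?P\<close>.\<close>
      have "l t1 * (c * k v + d * cnj (k v)) = c * (m t1 * k v) + d * (cnj (m t1) * cnj (k v))" for v
        using f(3) kT t1(1) cd[of v] cd[of "T t1 v"] by simp
      then have rel: "c * (l t1 - m t1) * k v = - d * (l t1 - cnj (m t1)) * cnj (k v)" for v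
        by (simp add: algebra_simps)
      show False
      proof (cases "c = 0")
        case True
        then show False using cd multiple_cnj[of d] by simp
      next
        case False
        define e where "e = - d * (l t1 - cnj (m t1)) / (c * (l t1 - m t1))"
        have "c * (l t1 - m t1) \<noteq> 0" using False t1 by simp
        then have "k v = e * cnj (k v)" for v
          using rel[of v] by (simp add: e_def field_simps)
        then have "f v = (c * e + d) * cnj (k v)" for v
          using cd[of v] by (metis distrib_right mult.assoc)
        then show False by (rule multiple_cnj)
      qed
    qed
  qed
qed


section \<open>Spaces of small dimension\<close>

lemma vector_space_real_scale: "vector_space s \<Longrightarrow> vector_space (real_scale s)"
  unfolding vector_space_def real_scale_def by simp

lemma real_scale_real: "real_scale s = s"
  by (simp add: real_scale_def fun_eq_iff)

lemma real_span_subset_span: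
  assumes "vector_space s"
  shows "module.span (real_scale s) F \<subseteq> module.span s F"
proof -
  interpret S: vector_space s by fact
  interpret R: vector_space "real_scale s" using assms by (rule vector_space_real_scale)
  show ?thesis
    by (rule R.span_minimal)
      (auto simp: R.subspace_def real_scale_def S.span_superset S.span_zero intro: S.span_add S.span_scale)
qed

lemma independent_card_3:
  assumes "vector_space s" "module.subspace s V" "ctwo <o alg_dim s V"
  obtains B where "B \<subseteq> V" "\<not> module.dependent s B" "card B = 3"
proof -
  interpret vector_space s by fact
  obtain B where B: "B \<subseteq> V" "independent B" "V \<subseteq> span B"
    using maximal_independent_subset[of V] by blast
  then have "span B = V" using assms(2) span_subspace by blast
  then have dim: "alg_dim s V =o |B|" using B by (intro alg_dim_basis assms(1)) auto
  have "\<exists>C\<subseteq>B. card C = 3"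
  proof (cases "finite B")
    case True
    have "\<not> card B \<le> 2"
    proof
      assume "card B \<le> 2"
      then have "card B \<le> card (UNIV :: bool set)" by simp
      from card_le_inj[OF True finite this] obtain g where "inj_on g B" "g ` B \<subseteq> (UNIV :: bool set)"
        by auto
      then have "|B| \<le>o ctwo" unfolding ctwo_def by (intro card_of_ordLeqI[of g]) auto
      then have "alg_dim s V \<le>o ctwo" using dim ordIso_ordLeq_trans by blast
      then show False using assms(3) not_ordLess_ordLeq by blast
    qed
    then have "3 \<le> card B" by simp
    then show ?thesis by (rule obtain_subset_with_card_n) blast
  next
    case False
    then show ?thesis using infinite_arbitrarily_large[of B 3] by blast
  qed
  then show ?thesis using B independent_mono that by blast
qed

text \<open>A complex line is spanned over the reals by \<open>b\<close> and
  \<open>s \<i> b\<close>, so it cannot hold three real-independent vectors.\<close>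

lemma complex_independent_card_2:
  fixes s :: "complex \<Rightarrow> 'v::ab_group_add \<Rightarrow> 'v"
  assumes "vector_space s" "module.subspace s V" "ctwo <o alg_dim (real_scale s) V"
  obtains B where "B \<subseteq> V" "\<not> module.dependent s B" "card B = 2"
proof -
  interpret vector_space s by fact
  interpret R: vector_space "real_scale s" using assms(1) by (rule vector_space_real_scale)
  have "R.subspace V"
    using assms(2) by (auto simp: R.subspace_def subspace_def real_scale_def)
  then obtain D where D: "D \<subseteq> V" "R.independent D" "card D = 3"
    using independent_card_3[OF R.vector_space_axioms _ assms(3)] by blast
  obtain B where B: "B \<subseteq> V" "independent B" "V \<subseteq> span B"
    using maximal_independent_subset[of V] by blast
  have "\<exists>C\<subseteq>B. card C = 2"
  proof (cases "finite B")
    case True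
    have "\<not> card B \<le> 1"
    proof
      assume "card B \<le> 1"
      then obtain b where "B \<subseteq> {b}"
        using True by (metis card_le_Suc0_iff_eq One_nat_def insertCI subsetI)
      then have "V \<subseteq> span {b}" using B(3) span_mono by blast
      also have "span {b} \<subseteq> R.span {b, s \<i> b}"
      proof
        fix v assume "v \<in> span {b}"
        then obtain z where "v = s z b" by (auto simp: span_singleton)
        also have "s z b = s (of_real (Re z) + of_real (Im z) * \<i>) b"
          by (subst complex_eq[of z]) (simp add: mult.commute)
        also have "\<dots> = real_scale s (Re z) b + real_scale s (Im z) (s \<i> b)"
          by (simp only: real_scale_def scale_left_distrib scale_scale)
        finally show "v \<in> R.span {b, s \<i> b}"
          by (auto intro!: R.span_add R.span_scale intro: R.span_base)
      qed
      finally have "card D \<le> card {b, s \<i> b}"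
        using R.independent_span_bound[OF _ D(2)] D(1) by simp
      also have "\<dots> \<le> 2" by (simp add: card_insert_if)
      finally show False using D(3) by simp
    qed
    then have "2 \<le> card B" by simp
    then show ?thesis by (rule obtain_subset_with_card_n) blast
  next
    case False
    then show ?thesis using infinite_arbitrarily_large[of B 2] by blast
  qed
  then show ?thesis using B independent_mono that by blast
qed

lemma subspace_continuous_dual:
  assumes "vector_space s"
  shows "module.subspace dual_scale (continuous_dual s)"
proof -
  interpret D: vector_space "dual_scale :: 'a \<Rightarrow> ('b \<Rightarrow> 'a) \<Rightarrow> _" by (rule vector_space_dual_scale)
  have mult: "vector_space ((*) :: 'a \<Rightarrow> 'a \<Rightarrow> 'a)" by standard (auto simp: algebra_simps)
  show ?thesis
    using assms mult
    by (auto simp: D.subspace_def continuous_dual_def Vector_Spaces.linear_iff dual_scale_def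
        plus_fun_def zero_fun_def algebra_simps intro!: continuous_intros)
qed

section \<open>Reduction of both dimension hypotheses to the dual\<close>

context supercyclic_semigroup
begin

lemma continuous_dual_T:
  assumes "g \<in> continuous_dual scl" "t \<ge> 0"
  shows "(\<lambda>v. g (T t v)) \<in> continuous_dual scl"
  using assms continuous_on_compose2[of UNIV g UNIV "T t"] continuous_T[of t]
  by (auto simp: continuous_dual_def Vector_Spaces.linear_iff T_add T_scl)

lemma closed_curve_orbit: "closed_curve (real_scale scl) (\<lambda>t. T t v)"
proof -
  interpret R: topological_vector_space "real_scale scl" by (rule real_scale)
  show ?thesis
  proof
    fix I :: "nat set set" and c c' t t'
    assume *: "finite I" "\<forall>i\<in>I. (\<lambda>k. c k i) \<longlonglongrightarrow> c' i" "\<forall>i\<in>I. (\<lambda>k. t k i) \<longlonglongrightarrow> t' i"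
      "\<forall>k. \<forall>i\<in>I. 0 < t k i" "\<forall>i\<in>I. 0 < t' i"
      "\<forall>k::nat. (\<Sum>i\<in>I. real_scale scl (c k i) (T (t k i) v)) = 0"
    have "(\<lambda>k. T (t k i) v) \<longlonglongrightarrow> T (t' i) v" if "i \<in> I" for i
      by (rule continuous_on_tendsto_compose[OF continuous_orbit])
        (use * that in \<open>auto simp: less_imp_le\<close>)
    then have "(\<lambda>k. \<Sum>i\<in>I. real_scale scl (c k i) (T (t k i) v)) \<longlonglongrightarrow>
        (\<Sum>i\<in>I. real_scale scl (c' i) (T (t' i) v))"
      using * by (intro tendsto_sum R.tendsto_scl) auto
    then show "(\<Sum>i\<in>I. real_scale scl (c' i) (T (t' i) v)) = 0"
      using *(6) LIMSEQ_unique by (simp add: LIMSEQ_const_iff)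
  qed
qed

text \<open>Relations between functionals are tested at each vector \<open>v\<close>, where
  \<open>g (T t v)\<close> is a continuous scalar function of \<open>t\<close>.\<close>

lemma closed_curve_dual:
  assumes "g \<in> continuous_dual scl"
  shows "closed_curve (real_scale dual_scale) (\<lambda>t v. g (T t v))"
proof -
  interpret R: vector_space "real_scale dual_scale :: real \<Rightarrow> ('a \<Rightarrow> 'k) \<Rightarrow> _"
    by (intro vector_space_real_scale vector_space_dual_scale)
  show ?thesis
  proof
    fix I :: "nat set set" and c c' t t'
    assume *: "finite I" "\<forall>i\<in>I. (\<lambda>k. c k i) \<longlonglongrightarrow> c' i" "\<forall>i\<in>I. (\<lambda>k. t k i) \<longlonglongrightarrow> t' i"
      "\<forall>k. \<forall>i\<in>I. 0 < t k i" "\<forall>i\<in>I. 0 < t' i"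
      "\<forall>k::nat. (\<Sum>i\<in>I. real_scale dual_scale (c k i) (\<lambda>v. g (T (t k i) v))) = 0"
    have "(\<Sum>i\<in>I. real_scale dual_scale (c' i) (\<lambda>v. g (T (t' i) v))) v = 0" for v
    proof -
      have "continuous_on {0..} (\<lambda>t. g (T t v))"
        using assms by (intro continuous_on_compose2[of UNIV g, OF _ continuous_orbit])
          (auto simp: continuous_dual_def)
      then have "(\<lambda>k. g (T (t k i) v)) \<longlonglongrightarrow> g (T (t' i) v)" if "i \<in> I" for i
        by (rule continuous_on_tendsto_compose) (use * that in \<open>auto simp: less_imp_le\<close>)
      then have "(\<lambda>k. \<Sum>i\<in>I. of_real (c k i) * g (T (t k i) v)) \<longlonglongrightarrow>
          (\<Sum>i\<in>I. of_real (c' i) * g (T (t' i) v))"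
        using * by (intro tendsto_intros) auto
      moreover have "(\<Sum>i\<in>I. of_real (c k i) * g (T (t k i) v)) = 0" for k
        using fun_cong[OF *(6)[rule_format, of k], of v]
        by (simp add: sum_fun_apply real_scale_def dual_scale_def)
      ultimately show ?thesis
        by (simp add: sum_fun_apply real_scale_def dual_scale_def LIMSEQ_const_iff)
    qed
    then show "(\<Sum>i\<in>I. real_scale dual_scale (c' i) (\<lambda>v. g (T (t' i) v))) = 0"
      by (simp add: fun_eq_iff)
  qed
qed

text \<open>The common outcome of the two hypotheses. The time \<open>a\<close> is there because the
  curve of a functional is caught by an invariant space only from some time on.\<close>

definition eventually_finite_dual :: bool where
  "eventually_finite_dual \<longleftrightarrow> (\<forall>g\<in>continuous_dual scl. \<exists>a\<ge>0. \<exists>F. finite F \<and> F \<subseteq> continuous_dual scl \<and>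
     (\<lambda>v. g (T a v)) \<in> module.span dual_scale F \<and>
     (\<forall>f\<in>F. \<forall>t\<ge>0. (\<lambda>v. f (T t v)) \<in> module.span dual_scale F))"

lemma small_dual_eventually_finite:
  assumes small: "real_dim_dual scl <o ctwo ^c natLeq"
  shows eventually_finite_dual
  unfolding eventually_finite_dual_def
proof
  fix g assume g: "g \<in> continuous_dual scl"
  let ?s = "real_scale dual_scale :: real \<Rightarrow> ('a \<Rightarrow> 'k) \<Rightarrow> _"
  interpret D: vector_space "dual_scale :: 'k \<Rightarrow> ('a \<Rightarrow> 'k) \<Rightarrow> _" by (rule vector_space_dual_scale)
  interpret R: vector_space ?s by (intro vector_space_real_scale vector_space_dual_scale)
  have sub: "R.subspace (continuous_dual scl)"
    using subspace_continuous_dual[OF vector_space_axioms]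
    by (auto simp: R.subspace_def D.subspace_def real_scale_def)
  have lin: "Vector_Spaces.linear ?s ?s (\<lambda>f v. f (T t v))" for t
    unfolding Vector_Spaces.linear_iff
    by (auto simp: R.vector_space_axioms real_scale_def dual_scale_def)
  obtain c G where G: "c > 0" "finite G" "G \<subseteq> (\<lambda>t v. g (T t v)) ` {0<..}"
    "\<And>t. t \<ge> c \<Longrightarrow> (\<lambda>v. g (T t v)) \<in> R.span G"
    "\<And>t f. t \<ge> 0 \<Longrightarrow> f \<in> R.span G \<Longrightarrow> (\<lambda>v. f (T t v)) \<in> R.span G"
  proof (rule small_dim_eventually_invariant[OF closed_curve_dual[OF g] sub])
    show "(\<lambda>t v. g (T t v)) ` {0<..} \<subseteq> continuous_dual scl"
      using continuous_dual_T[OF g] by auto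
    show "alg_dim ?s (continuous_dual scl) <o ctwo ^c natLeq"
      using small by (simp add: real_dim_dual_def)
    show "Vector_Spaces.linear ?s ?s (\<lambda>f v. f (T t v))" for t by (rule lin)
    show "(\<lambda>v. g (T u (T t v))) = (\<lambda>v. g (T (t + u) v))" if "t \<ge> 0" "u > 0" for t u
      using that by (simp add: T_T)
  qed blast
  have "G \<subseteq> continuous_dual scl" using G(3) continuous_dual_T[OF g] by auto
  moreover have "(\<lambda>v. f (T t v)) \<in> D.span G" if "f \<in> G" "t \<ge> 0" for f t
    using G(5)[OF that(2) R.span_base[OF that(1)]] real_span_subset_span[OF vector_space_dual_scale] by blast
  moreover have "(\<lambda>v. g (T c v)) \<in> D.span G"
    using G(4)[of c] real_span_subset_span[OF vector_space_dual_scale] by blast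
  ultimately show "\<exists>a\<ge>0. \<exists>F. finite F \<and> F \<subseteq> continuous_dual scl \<and>
     (\<lambda>v. g (T a v)) \<in> D.span F \<and> (\<forall>f\<in>F. \<forall>t\<ge>0. (\<lambda>v. f (T t v)) \<in> D.span F)"
    using G(1,2) by (intro exI[of _ c] conjI exI[of _ G]) auto
qed

text \<open>The curve of \<open>x\<close> alone suffices: from time \<open>c\<close> on it lies in
  the closed space \<open>span G\<close>, so \<open>T c\<close> maps the dense projective orbit,
  hence everything, into \<open>span G\<close>. Since the range of \<open>T c\<close> is dense,
  \<open>span G\<close> is the whole space.\<close>

lemma small_dim_finite:
  assumes small: "real_dim scl <o ctwo ^c natLeq" and nontriv: "\<exists>v::'a. v \<noteq> 0"
  obtains G where "finite G" "span G = UNIV"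
proof -
  interpret R: topological_vector_space "real_scale scl" by (rule real_scale)
  have lin: "Vector_Spaces.linear (real_scale scl) (real_scale scl) (T t)" if "t \<ge> 0" for t
    unfolding Vector_Spaces.linear_iff using that
    by (auto simp: R.vector_space_axioms real_scale_def T_add T_scl)
  obtain c G where G: "c > 0" "finite G" "G \<subseteq> (\<lambda>t. T t x) ` {0<..}"
    "\<And>t. t \<ge> c \<Longrightarrow> T t x \<in> R.span G"
    "\<And>t v. t \<ge> 0 \<Longrightarrow> v \<in> R.span G \<Longrightarrow> T t v \<in> R.span G"
  proof (rule small_dim_eventually_invariant[OF closed_curve_orbit R.subspace_UNIV])
    show "alg_dim (real_scale scl) UNIV <o ctwo ^c natLeq"
      using small by (simp add: real_dim_def)
    show "Vector_Spaces.linear (real_scale scl) (real_scale scl) (T t)" if "t \<ge> 0" for t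
      using that by (rule lin)
    show "T t (T u x) = T (t + u) x" if "t \<ge> 0" "u > 0" for t u
      using that by (simp add: T_T add.commute)
  qed blast+
  have closed: "closed (span G)" by (rule closed_span_finite[OF compact_cball G(2)])
  have "T c v \<in> span G" for v
  proof (rule orbit_closed_induct[where P = "\<lambda>v. T c v \<in> span G"])
    show "closed {v. T c v \<in> span G}"
      using closed_vimage[OF closed continuous_T[of c]] G(1) by (simp add: vimage_def)
    show "T c (scl z (T t x)) \<in> span G" if "t \<ge> 0" for z t
      using G(1) G(4)[of "t + c"] that real_span_subset_span[OF vector_space_axioms, of G]
      by (auto simp: T_scl T_T intro!: span_scale)
  qed
  then have "closure (range (T c)) \<subseteq> span G"
    using closed by (intro closure_minimal) auto
  then have "span G = UNIV" using dense_range[OF nontriv, of c] G(1) by auto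
  then show ?thesis using G(2) that by blast
qed

text \<open>\<open>e\<close> is the dual basis. The kernel of the coordinate \<open>e b\<close> is
  \<open>span (B - {b})\<close>, which is closed, so \<open>continuous_functional\<close> makes
  \<open>e b\<close> continuous.\<close>

lemma finite_dim_dual:
  assumes B: "independent B" "finite B" "span B = UNIV"
  obtains e where "inj_on e B" "e ` B \<subseteq> continuous_dual scl"
    "continuous_dual scl \<subseteq> module.span dual_scale (e ` B)" "\<not> module.dependent dual_scale (e ` B)"
proof -
  interpret D: vector_space "dual_scale :: 'k \<Rightarrow> ('a \<Rightarrow> 'k) \<Rightarrow> _" by (rule vector_space_dual_scale)
  have mult: "vector_space ((*) :: 'k \<Rightarrow> 'k \<Rightarrow> 'k)" by standard (auto simp: algebra_simps)
  define e where "e b = (\<lambda>v. representation B v b)" for b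
  have eb: "e b b' = (if b' = b then 1 else 0)" if "b' \<in> B" for b b'
    using representation_basis[OF B(1) that] by (simp add: e_def)
  have e_sum: "(\<Sum>b\<in>B. scl (e b v) b) = v" for v
    unfolding e_def using B by (intro sum_representation_eq) auto
  have e_lin: "Vector_Spaces.linear scl (*) (e b)" for b
    unfolding Vector_Spaces.linear_iff e_def using B mult vector_space_axioms
    by (auto simp: representation_add representation_scale)
  have e_cont: "continuous_on UNIV (e b)" if "b \<in> B" for b
  proof (rule continuous_functional[OF e_lin])
    have "{v. e b v = 0} = span (B - {b})"
    proof (intro set_eqI iffI)
      fix v assume "v \<in> {v. e b v = 0}"
      then have "v = (\<Sum>b'\<in>B - {b}. scl (e b' v) b')"
        using e_sum[of v] by (simp add: sum.remove[OF B(2) that])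
      also have "\<dots> \<in> span (B - {b})"
        by (intro span_sum span_scale span_base)
      finally show "v \<in> span (B - {b})" .
    next
      fix v assume "v \<in> span (B - {b})"
      interpret e: Vector_Spaces.linear scl "(*)" "e b" by (rule e_lin)
      show "v \<in> {v. e b v = 0}"
        using \<open>v \<in> span (B - {b})\<close>
        by (induction rule: span_induct_alt) (auto simp: e.zero e.add e.scale eb)
    qed
    then show "closed {v. e b v = 0}"
      using closed_span_finite[OF compact_cball, of "B - {b}"] B(2) by simp
  qed
  have inj: "inj_on e B"
    by (rule inj_onI) (metis eb zero_neq_one)
  show ?thesis
  proof (rule that[of e])
    show "e ` B \<subseteq> continuous_dual scl"
      using e_lin e_cont by (auto simp: continuous_dual_def)
    show "continuous_dual scl \<subseteq> D.span (e ` B)"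
    proof
      fix g assume "g \<in> continuous_dual scl"
      then interpret g: Vector_Spaces.linear scl "(*)" g by (simp add: continuous_dual_def)
      have "g v = (\<Sum>b\<in>B. dual_scale (g b) (e b)) v" for v
        by (subst e_sum[of v, symmetric])
          (simp add: g.sum g.scale sum_fun_apply dual_scale_def mult.commute)
      then have "g = (\<Sum>b\<in>B. dual_scale (g b) (e b))" by (rule ext)
      also have "\<dots> \<in> D.span (e ` B)"
        by (intro D.span_sum D.span_scale D.span_base) auto
      finally show "g \<in> D.span (e ` B)" .
    qed
    show "D.independent (e ` B)"
    proof (rule D.independent_if_scalars_zero)
      fix u h assume *: "(\<Sum>h\<in>e ` B. dual_scale (u h) h) = 0" and "h \<in> e ` B"
      then obtain b where b: "b \<in> B" "h = e b" by auto
      have "(\<Sum>b'\<in>B. u (e b') * e b' b) = 0"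
        using fun_cong[OF *, of b] inj by (simp add: sum.reindex sum_fun_apply dual_scale_def)
      also have "(\<Sum>b'\<in>B. u (e b') * e b' b) = u (e b)"
        using b B(2) by (simp add: eb if_distrib cong: if_cong)
      finally show "u h = 0" using b by simp
    qed (use B in simp)
  qed (rule inj)
qed

lemma small_dim_dual:
  assumes small: "real_dim scl <o ctwo ^c natLeq"
    and B: "independent B" "card B = n" "n > 0"
  shows "eventually_finite_dual \<and>
    (\<exists>C\<subseteq>continuous_dual scl. \<not> module.dependent dual_scale C \<and> card C = n)"
proof -
  interpret D: vector_space "dual_scale :: 'k \<Rightarrow> ('a \<Rightarrow> 'k) \<Rightarrow> _" by (rule vector_space_dual_scale)
  have "B \<noteq> {}" "finite B" using B card.infinite by fastforce+
  then have nontriv: "\<exists>v::'a. v \<noteq> 0" using B(1) dependent_zero[of B] by (metis all_not_in_conv)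
  obtain G where G: "finite G" "span G = UNIV" using small_dim_finite[OF small nontriv] .
  obtain E where E: "B \<subseteq> E" "E \<subseteq> UNIV" "independent E" "UNIV \<subseteq> span E"
    by (rule maximal_independent_subset_extend[OF subset_UNIV B(1)])
  then have spanE: "span E = UNIV" by auto
  have "finite E" using independent_span_bound[OF G(1) E(3)] G(2) by simp
  obtain e where e: "inj_on e E" "e ` E \<subseteq> continuous_dual scl"
    "continuous_dual scl \<subseteq> D.span (e ` E)" "\<not> D.dependent (e ` E)"
    by (rule finite_dim_dual[OF E(3) \<open>finite E\<close> spanE])
  have eventually_finite_dual
    unfolding eventually_finite_dual_def
  proof
    fix g assume g: "g \<in> continuous_dual scl"
    have "(\<lambda>v. g (T 0 v)) \<in> D.span (e ` E)" using g e(3) by (auto simp: T_0)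
    moreover have "(\<lambda>v. f (T t v)) \<in> D.span (e ` E)" if "f \<in> e ` E" "t \<ge> 0" for f t
      using continuous_dual_T[of f t] that e(2,3) by blast
    ultimately show "\<exists>a\<ge>0. \<exists>F. finite F \<and> F \<subseteq> continuous_dual scl \<and>
       (\<lambda>v. g (T a v)) \<in> D.span F \<and> (\<forall>f\<in>F. \<forall>t\<ge>0. (\<lambda>v. f (T t v)) \<in> D.span F)"
      using e(2) \<open>finite E\<close> by (intro exI[of _ 0] conjI exI[of _ "e ` E"]) auto
  qed
  moreover have "e ` B \<subseteq> continuous_dual scl" "D.independent (e ` B)" "card (e ` B) = n"
    using subset_trans[OF image_mono[OF E(1)] e(2)] D.independent_mono[OF e(4) image_mono[OF E(1)]]
      card_image[OF inj_on_subset[OF e(1) E(1)]] B(2)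
    by auto
  ultimately show ?thesis by blast
qed

text \<open>Times add and generating sets unite: by invariance, a functional caught by one of the
  spans stays there under the additional time.\<close>

lemma eventually_finite_dual_finite:
  assumes eventually_finite_dual "finite B" "B \<subseteq> continuous_dual scl"
  shows "\<exists>a\<ge>0. \<exists>F. finite F \<and> F \<subseteq> continuous_dual scl \<and>
     (\<forall>g\<in>B. (\<lambda>v. g (T a v)) \<in> module.span dual_scale F) \<and>
     (\<forall>f\<in>F. \<forall>t\<ge>0. (\<lambda>v. f (T t v)) \<in> module.span dual_scale F)"
  using assms(2,3)
proof (induction B)
  case empty
  then show ?case by (intro exI[of _ 0] conjI exI[of _ "{}"]) auto
next
  case (insert g B)
  interpret D: vector_space "dual_scale :: 'k \<Rightarrow> ('a \<Rightarrow> 'k) \<Rightarrow> _" by (rule vector_space_dual_scale)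
  obtain a F where F: "a \<ge> 0" "finite F" "F \<subseteq> continuous_dual scl"
    "\<forall>g\<in>B. (\<lambda>v. g (T a v)) \<in> D.span F" "\<forall>f\<in>F. \<forall>t\<ge>0. (\<lambda>v. f (T t v)) \<in> D.span F"
    using insert by auto
  obtain b H where H: "b \<ge> 0" "finite H" "H \<subseteq> continuous_dual scl"
    "(\<lambda>v. g (T b v)) \<in> D.span H" "\<forall>f\<in>H. \<forall>t\<ge>0. (\<lambda>v. f (T t v)) \<in> D.span H"
    using assms(1) insert.prems unfolding eventually_finite_dual_def by auto
  have FH: "D.span F \<subseteq> D.span (F \<union> H)" "D.span H \<subseteq> D.span (F \<union> H)"
    by (auto intro!: D.span_mono)
  have "(\<lambda>v. h (T (a + b) v)) \<in> D.span (F \<union> H)" if "h \<in> insert g B" for h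
  proof (cases "h = g")
    case True
    have "(\<lambda>v. g (T b (T a v))) \<in> D.span H"
      using span_comp[of H "T a", OF _ H(4)] H(5) F(1) by blast
    then show ?thesis using True FH T_T[OF F(1) H(1)] by auto
  next
    case False
    then have "(\<lambda>v. h (T a v)) \<in> D.span F" using that F(4) by auto
    then have "(\<lambda>v. h (T a (T b v))) \<in> D.span F"
      using span_comp[of F "T b" "\<lambda>v. h (T a v)"] F(5) H(1) by blast
    then show ?thesis using FH T_T[OF H(1) F(1)] by (auto simp: add.commute)
  qed
  moreover have "\<forall>f\<in>F \<union> H. \<forall>t\<ge>0. (\<lambda>v. f (T t v)) \<in> D.span (F \<union> H)"
    using F(5) H(5) FH by blast
  ultimately show ?case
    using F H by (intro exI[of _ "a + b"] conjI exI[of _ "F \<union> H"]) auto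
qed

text \<open>Composition with \<open>T a\<close> is injective on the continuous dual by
  \<open>comp_T_eq_0\<close>, so the image of \<open>B\<close> is still independent and now sits in
  the invariant space \<open>span F\<close>.\<close>

lemma eventually_finite_dual_invariant:
  assumes eventually_finite_dual and B: "B \<subseteq> continuous_dual scl" "\<not> module.dependent dual_scale B"
    "card B = n" "n > 0"
  obtains F C where "finite F" "F \<subseteq> continuous_dual scl"
    "\<And>t g. t \<ge> 0 \<Longrightarrow> g \<in> F \<Longrightarrow> (\<lambda>v. g (T t v)) \<in> module.span dual_scale F"
    "C \<subseteq> module.span dual_scale F" "\<not> module.dependent dual_scale C" "card C = n"
proof -
  interpret D: vector_space "dual_scale :: 'k \<Rightarrow> ('a \<Rightarrow> 'k) \<Rightarrow> _" by (rule vector_space_dual_scale)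
  have "finite B" using B(3,4) card.infinite by fastforce
  then obtain a F where F: "a \<ge> 0" "finite F" "F \<subseteq> continuous_dual scl"
    "\<forall>g\<in>B. (\<lambda>v. g (T a v)) \<in> D.span F" "\<forall>f\<in>F. \<forall>t\<ge>0. (\<lambda>v. f (T t v)) \<in> D.span F"
    using eventually_finite_dual_finite[OF assms(1) _ B(1)] by blast
  let ?A = "\<lambda>(g :: 'a \<Rightarrow> 'k) v. g (T a v)"
  interpret A: Vector_Spaces.linear "dual_scale :: 'k \<Rightarrow> ('a \<Rightarrow> 'k) \<Rightarrow> _" dual_scale ?A
    by (rule linear_comp_dual_scale)
  have spanB: "D.span B \<subseteq> continuous_dual scl"
    by (intro D.span_minimal B subspace_continuous_dual vector_space_axioms)
  have "inj_on ?A (D.span B)"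
  proof (subst A.inj_on_iff_eq_0[OF D.subspace_span], intro ballI impI)
    fix g assume "g \<in> D.span B" "?A g = 0"
    then have g: "g \<in> continuous_dual scl" using spanB by blast
    then interpret g: Vector_Spaces.linear scl "(*)" g by (simp add: continuous_dual_def)
    have "g (T a v) = 0" for v using fun_cong[OF \<open>?A g = 0\<close>, of v] by simp
    then have "g v = 0" for v
      using comp_T_eq_0[of g a v] F(1) g g.zero by (auto simp: continuous_dual_def)
    then show "g = 0" by (simp add: fun_eq_iff)
  qed
  then have "D.independent (?A ` B)" "card (?A ` B) = n"
    using B(2,3) A.independent_injective_image D.span_superset
    by (auto simp: card_image inj_on_subset)
  then show ?thesis
    using F by (intro that[of F "?A ` B"]) auto
qed

end

section \<open>The contradiction over each scalar field\<close>

lemma no_supercyclic_real: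
  fixes s :: "real \<Rightarrow> 'a::{topological_ab_group_add,t2_space} \<Rightarrow> 'a"
  assumes "topological_vector_space s"
    and dim: "ctwo <o real_dim s \<and> real_dim s <o ctwo ^c natLeq \<or>
      ctwo <o real_dim_dual s \<and> real_dim_dual s <o ctwo ^c natLeq"
    and T: "operator_semigroup s T" "strongly_continuous T" "supercyclic s T"
  shows False
proof -
  obtain x where "closure {s z (T t x) | z t. 0 \<le> t} = UNIV"
    using T(3) by (auto simp: supercyclic_def)
  then interpret supercyclic_semigroup s T x
    using assms by (intro supercyclic_semigroup.intro supercyclic_semigroup_axioms.intro)
  interpret D: vector_space "dual_scale :: real \<Rightarrow> ('a \<Rightarrow> real) \<Rightarrow> _" by (rule vector_space_dual_scale)
  have "eventually_finite_dual \<and> (\<exists>C\<subseteq>continuous_dual s. D.independent C \<and> card C = 3)"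
    using dim
  proof
    assume *: "ctwo <o real_dim s \<and> real_dim s <o ctwo ^c natLeq"
    then obtain B where "independent B" "card B = 3"
      using independent_card_3[OF vector_space_axioms subspace_UNIV]
      by (auto simp: real_dim_def real_scale_real)
    then show ?thesis using small_dim_dual * by simp
  next
    assume *: "ctwo <o real_dim_dual s \<and> real_dim_dual s <o ctwo ^c natLeq"
    then obtain B where "B \<subseteq> continuous_dual s" "D.independent B" "card B = 3"
      using independent_card_3[OF vector_space_dual_scale subspace_continuous_dual[OF vector_space_axioms]]
      by (auto simp: real_dim_dual_def real_scale_real)
    then show ?thesis using small_dual_eventually_finite * by blast
  qed
  then obtain B where ev: eventually_finite_dual and B: "B \<subseteq> continuous_dual s" "D.independent B" "card B = 3"
    by blast
  obtain F C where F: "finite F" "F \<subseteq> continuous_dual s"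
    "\<And>t g. t \<ge> 0 \<Longrightarrow> g \<in> F \<Longrightarrow> (\<lambda>v. g (T t v)) \<in> D.span F"
    and C: "C \<subseteq> D.span F" "D.independent C" "card C = 3"
    by (rule eventually_finite_dual_invariant[OF ev B]) simp_all
  have "card C < 3"
    by (rule real_invariant_functionals[OF supercyclic_semigroup_axioms F C(1,2)])
  with C(3) show False by simp
qed

lemma no_supercyclic_complex:
  fixes s :: "complex \<Rightarrow> 'a::{topological_ab_group_add,t2_space} \<Rightarrow> 'a"
  assumes "topological_vector_space s"
    and dim: "ctwo <o real_dim s \<and> real_dim s <o ctwo ^c natLeq \<or>
      ctwo <o real_dim_dual s \<and> real_dim_dual s <o ctwo ^c natLeq"
    and T: "operator_semigroup s T" "strongly_continuous T" "supercyclic s T"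
  shows False
proof -
  obtain x where "closure {s z (T t x) | z t. 0 \<le> t} = UNIV"
    using T(3) by (auto simp: supercyclic_def)
  then interpret supercyclic_semigroup s T x
    using assms by (intro supercyclic_semigroup.intro supercyclic_semigroup_axioms.intro)
  have "eventually_finite_dual \<and> (\<exists>C\<subseteq>continuous_dual s. dual.independent C \<and> card C = 2)"
    using dim
  proof
    assume *: "ctwo <o real_dim s \<and> real_dim s <o ctwo ^c natLeq"
    then obtain B where "independent B" "card B = 2"
      using complex_independent_card_2[OF vector_space_axioms subspace_UNIV]
      by (auto simp: real_dim_def)
    then show ?thesis using small_dim_dual * by simp
  next
    assume *: "ctwo <o real_dim_dual s \<and> real_dim_dual s <o ctwo ^c natLeq"
    then obtain B where "B \<subseteq> continuous_dual s" "dual.independent B" "card B = 2"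
      using complex_independent_card_2[OF vector_space_dual_scale subspace_continuous_dual[OF vector_space_axioms]]
      by (auto simp: real_dim_dual_def)
    then show ?thesis using small_dual_eventually_finite * by blast
  qed
  then obtain B where ev: eventually_finite_dual and B: "B \<subseteq> continuous_dual s" "dual.independent B" "card B = 2"
    by blast
  obtain F C where F: "finite F" "F \<subseteq> continuous_dual s"
    "\<And>t g. t \<ge> 0 \<Longrightarrow> g \<in> F \<Longrightarrow> (\<lambda>v. g (T t v)) \<in> dual.span F"
    and C: "C \<subseteq> dual.span F" "dual.independent C" "card C = 2"
    by (rule eventually_finite_dual_invariant[OF ev B]) simp_all
  have "card C < 2"
    by (rule complex_invariant_functionals[OF supercyclic_semigroup_axioms F C(1,2)])
  with C(3) show False by simp
qed


theorem theorem1p6: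
  fixes sR :: "real \<Rightarrow> 'a::{topological_ab_group_add,t2_space} \<Rightarrow> 'a"
    and sC :: "complex \<Rightarrow> 'b::{topological_ab_group_add,t2_space} \<Rightarrow> 'b"
  shows "(topological_vector_space sR \<and>
           ((ctwo <o real_dim sR \<and> real_dim sR <o ctwo ^c natLeq) \<or>
            (ctwo <o real_dim_dual sR \<and> real_dim_dual sR <o ctwo ^c natLeq)) \<longrightarrow>
           \<not> (\<exists>T. operator_semigroup sR T \<and> strongly_continuous T \<and> supercyclic sR T)) \<and>
         (topological_vector_space sC \<and>
           ((ctwo <o real_dim sC \<and> real_dim sC <o ctwo ^c natLeq) \<or>
            (ctwo <o real_dim_dual sC \<and> real_dim_dual sC <o ctwo ^c natLeq)) \<longrightarrow>
           \<not> (\<exists>T. operator_semigroup sC T \<and> strongly_continuous T \<and> supercyclic sC T))"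
  using no_supercyclic_real no_supercyclic_complex by blast

end
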